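(* Let $V\subset\Lambda$ be a good set. For any integers $k_v\in\{1,\dots,\deg_{\mathcal G}(v)\}$, $v\in V$, it holds that $$\mathbb P\big(D_v=k_v,\ v\in V\big)=\mathbb E\Big[\prod_{v\in V}\delta_v^{(k_v)}\Big]=\Big\langle\prod_{v\in V}X_v^{(k_v)}\,Y_v\Big\rangle .$$
   Context: **Graph.** Let $\mathbf L$ be a connected, locally finite simple graph (for example a lattice), and let $\Lambda$ be a finite nonempty proper subset of its vertex set. $E$ denotes the set of edges of $\mathbf L$ having at least one endpoint in $\Lambda$; each edge $e\in E$ is given a fixed orientation $e=(e^-,e^+)$ (tail, tip). For $v\in\Lambda$, $E_v\subseteq E$ is the set of edges incident to $v$, and $\deg_{\mathcal G}(v)=|E_v|$. The wired graph is the finite connected multigraph with edge set $E$ obtained by identifying all vertices outside $\Lambda$ to a single vertex. (An arbitrary finite connected graph is covered by taking $\Lambda$ to be all its vertices but one.) The uniform spanning tree (UST) measure $\mathbb P$ (expectation $\mathbb E$) is the uniform probability measure on spanning trees $T\subseteq E$ of the wired graph. A set $V\subseteq\Lambda$ is *good* if no two of its elements are nearest neighbours in $\mathbf L$. **Degree field.** For $v\in\Lambda$, $D_v=\sum_{e\in E_v}\mathbf 1_{\{e\in T\}}$ and $\delta_v^{(k)}=\mathbf 1_{\{D_v=k\}}$. **Laplacian.** $\Delta_\Lambda$ is the $\Lambda\times\Lambda$ matrix with $\Delta_\Lambda(u,u)=-|\{w\in\mathbf L: w\sim u\}|$, $\Delta_\Lambda(u,v)=1$ if $u\sim v$, and $0$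 otherwise. **Fermions.** $\Omega^{2\Lambda}$ is the real Grassmann algebra with generators $\psi_v,\bar\psi_v$ ($v\in\Lambda$), all of which anticommute with each other (in particular they square to $0$). For a generator $\xi$, $\partial_\xi$ is the left derivative: the linear map with $\partial_\xi(\xi P)=P$ and $\partial_\xi P=0$ for every $P$ not involving $\xi$. The normalized fermionic Gaussian free field state is the linear map $$\langle P\rangle=\frac{1}{\det(-\Delta_\Lambda)}\Big(\prod_{v\in\Lambda}\partial_{\bar\psi_v}\partial_{\psi_v}\Big)\exp\Big(\sum_{u,v\in\Lambda}\psi_u(-\Delta_\Lambda)(u,v)\bar\psi_v\Big)P,\qquad P\in\Omega^{2\Lambda}.$$ Put $\psi_v=\bar\psi_v=0$ for $v\notin\Lambda$. For $e\in E$, $\zeta(e)=(\psi_{e^+}-\psi_{e^-})(\bar\psi_{e^+}-\bar\psi_{e^-})$; these elements commute and do not depend on the orientation of $e$. For $v\in\Lambda$ and $k\in\{1,\dots,\deg_{\mathcal G}(v)\}$, $$X_v^{(k)}=\sum_{\mathcal E\subseteq E_v:\,|\mathcal E|=k}\ \prod_{e\in\mathcal E}\zeta(e),\qquad Y_v=\prod_{e\in E_v}\big(1-\zeta(e)\big).$$ *)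

theory Defs
  imports "HOL-Probability.Probability" "HOL-Library.Groups_Big_Fun"
begin

section \<open>The Grassmann algebra\<close>

text \<open>
  The real Grassmann algebra on an arbitrary type of generators. An element is given by its
  coefficients with respect to the basis of monomials, one for each finite set of generators; the
  monomial of a set is the product of its elements in increasing order. The order only serves to
  fix these signs, so it is chosen arbitrarily.
\<close>

definition gen_less :: "'g \<Rightarrow> 'g \<Rightarrow> bool" (infix \<open>\<lhd>\<close> 50) where
  "x \<lhd> y \<longleftrightarrow> x \<noteq> y \<and> (x, y) \<in> (SOME r. linear_order_on UNIV r)"

lemma gen_order: "linear_order_on UNIV (SOME r :: 'g rel. linear_order_on UNIV r)"
proof -
  obtain r :: "'g rel" where "well_order_on UNIV r"
    using Zorn.well_order_on by blast
  then show ?thesis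
    by (metis someI_ex well_order_on_def)
qed

lemma gen_less_irrefl [simp]: "\<not> x \<lhd> x"
  by (simp add: gen_less_def)

lemma gen_less_asym: "x \<lhd> y \<Longrightarrow> \<not> y \<lhd> x"
  using gen_order
  by (metis antisymD gen_less_def linear_order_on_def partial_order_on_def)

lemma gen_less_linear: "x \<noteq> y \<Longrightarrow> x \<lhd> y \<or> y \<lhd> x"
  using gen_order
  by (metis UNIV_I gen_less_def linear_order_on_def total_on_def)

lemma gen_less_trans: "x \<lhd> y \<Longrightarrow> y \<lhd> z \<Longrightarrow> x \<lhd> z"
  using gen_order gen_less_asym
  by (metis gen_less_def linear_order_on_def partial_order_on_def preorder_on_def transD)

text \<open>
  For disjoint \<open>A\<close> and \<open>B\<close>, the monomial of \<open>A\<close> times the monomial of \<open>B\<close> is \<open>gsign A B\<close> times the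
  monomial of \<open>A \<union> B\<close>.
\<close>

definition gsign :: "'g set \<Rightarrow> 'g set \<Rightarrow> real" where
  "gsign A B = (- 1) ^ card {(a, b) \<in> A \<times> B. b \<lhd> a}"

lemma gsign_empty [simp]: "gsign {} B = 1" "gsign A {} = 1"
  by (simp_all add: gsign_def)

lemma gsign_Un_left:
  assumes "finite A" "finite B" "finite C" "A \<inter> B = {}"
  shows "gsign (A \<union> B) C = gsign A C * gsign B C"
proof -
  have *: "{(a, b) \<in> (A \<union> B) \<times> C. b \<lhd> a} =
      {(a, b) \<in> A \<times> C. b \<lhd> a} \<union> {(a, b) \<in> B \<times> C. b \<lhd> a}"
    by auto
  have "finite {(a, b) \<in> A \<times> C. b \<lhd> a}" "finite {(a, b) \<in> B \<times> C. b \<lhd> a}"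
    using assms by (auto intro: finite_subset[of _ "A \<times> C"] finite_subset[of _ "B \<times> C"])
  then show ?thesis
    unfolding gsign_def * power_add [symmetric]
    using assms by (subst card_Un_disjoint) auto
qed

lemma gsign_Un_right:
  assumes "finite A" "finite B" "finite C" "B \<inter> C = {}"
  shows "gsign A (B \<union> C) = gsign A B * gsign A C"
proof -
  have *: "{(a, b) \<in> A \<times> (B \<union> C). b \<lhd> a} =
      {(a, b) \<in> A \<times> B. b \<lhd> a} \<union> {(a, b) \<in> A \<times> C. b \<lhd> a}"
    by auto
  have "finite {(a, b) \<in> A \<times> B. b \<lhd> a}" "finite {(a, b) \<in> A \<times> C. b \<lhd> a}"
    using assms by (auto intro: finite_subset[of _ "A \<times> B"] finite_subset[of _ "A \<times> C"])
  then show ?thesis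
    unfolding gsign_def * power_add [symmetric]
    using assms by (subst card_Un_disjoint) auto
qed

lemma gsign_square [simp]: "gsign A B * gsign A B = 1"
  by (simp add: gsign_def flip: power_add mult_2)

typedef 'g grassmann =
  "{f :: 'g set \<Rightarrow> real. finite {S. f S \<noteq> 0} \<and> (\<forall>S. infinite S \<longrightarrow> f S = 0)}"
  morphisms gcoeff Grassmann
  by (rule exI[of _ "\<lambda>_. 0"]) simp

setup_lifting type_definition_grassmann

lemma gcoeff_infinite: "infinite S \<Longrightarrow> gcoeff f S = 0"
  by transfer blast

lemma gcoeff_eqI:
  assumes "\<And>S. finite S \<Longrightarrow> gcoeff f S = gcoeff g S"
  shows "f = g"
proof -
  have "gcoeff f S = gcoeff g S" for S
    using assms by (cases "finite S") (simp_all add: gcoeff_infinite)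
  then show ?thesis
    by (metis ext gcoeff_inject)
qed

instantiation grassmann :: (type) real_vector
begin

lift_definition zero_grassmann :: "'a grassmann" is "\<lambda>_. 0" by simp

lift_definition plus_grassmann :: "'a grassmann \<Rightarrow> 'a grassmann \<Rightarrow> 'a grassmann"
  is "\<lambda>f g S. f S + g S"
proof -
  fix f g :: "'a set \<Rightarrow> real"
  assume "finite {S. f S \<noteq> 0} \<and> (\<forall>S. infinite S \<longrightarrow> f S = 0)"
    "finite {S. g S \<noteq> 0} \<and> (\<forall>S. infinite S \<longrightarrow> g S = 0)"
  then show "finite {S. f S + g S \<noteq> 0} \<and> (\<forall>S. infinite S \<longrightarrow> f S + g S = 0)"
    by (auto intro: finite_subset[of _ "{S. f S \<noteq> 0} \<union> {S. g S \<noteq> 0}"])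
qed

lift_definition uminus_grassmann :: "'a grassmann \<Rightarrow> 'a grassmann" is "\<lambda>f S. - f S" by simp

lift_definition minus_grassmann :: "'a grassmann \<Rightarrow> 'a grassmann \<Rightarrow> 'a grassmann"
  is "\<lambda>f g S. f S - g S"
proof -
  fix f g :: "'a set \<Rightarrow> real"
  assume "finite {S. f S \<noteq> 0} \<and> (\<forall>S. infinite S \<longrightarrow> f S = 0)"
    "finite {S. g S \<noteq> 0} \<and> (\<forall>S. infinite S \<longrightarrow> g S = 0)"
  then show "finite {S. f S - g S \<noteq> 0} \<and> (\<forall>S. infinite S \<longrightarrow> f S - g S = 0)"
    by (auto intro: finite_subset[of _ "{S. f S \<noteq> 0} \<union> {S. g S \<noteq> 0}"])
qed

lift_definition scaleR_grassmann :: "real \<Rightarrow> 'a grassmann \<Rightarrow> 'a grassmann"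
  is "\<lambda>c f S. c * f S"
proof -
  fix c and f :: "'a set \<Rightarrow> real"
  assume "finite {S. f S \<noteq> 0} \<and> (\<forall>S. infinite S \<longrightarrow> f S = 0)"
  then show "finite {S. c * f S \<noteq> 0} \<and> (\<forall>S. infinite S \<longrightarrow> c * f S = 0)"
    by (auto intro: finite_subset[of _ "{S. f S \<noteq> 0}"])
qed

instance
  by standard (transfer, simp add: fun_eq_iff algebra_simps)+

end

instantiation grassmann :: (type) real_algebra_1
begin

lift_definition one_grassmann :: "'a grassmann" is "\<lambda>S. if S = {} then 1 else 0" by auto

lift_definition times_grassmann :: "'a grassmann \<Rightarrow> 'a grassmann \<Rightarrow> 'a grassmann"
  is "\<lambda>f g S. \<Sum>A\<in>Pow S. gsign A (S - A) * f A * g (S - A)"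
proof -
  fix f g :: "'a set \<Rightarrow> real"
  assume f: "finite {S. f S \<noteq> 0} \<and> (\<forall>S. infinite S \<longrightarrow> f S = 0)"
    and g: "finite {S. g S \<noteq> 0} \<and> (\<forall>S. infinite S \<longrightarrow> g S = 0)"
  let ?h = "\<lambda>S. \<Sum>A\<in>Pow S. gsign A (S - A) * f A * g (S - A)"
  have "{S. ?h S \<noteq> 0} \<subseteq> (\<lambda>(A, B). A \<union> B) ` ({S. f S \<noteq> 0} \<times> {S. g S \<noteq> 0})"
  proof
    fix S assume "S \<in> {S. ?h S \<noteq> 0}"
    then have "?h S \<noteq> 0" by simp
    then obtain A where A: "A \<in> Pow S" "gsign A (S - A) * f A * g (S - A) \<noteq> 0"
      by (rule sum.not_neutral_contains_not_neutral)
    then have "S = (\<lambda>(A, B). A \<union> B) (A, S - A)" by auto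
    then show "S \<in> (\<lambda>(A, B). A \<union> B) ` ({S. f S \<noteq> 0} \<times> {S. g S \<noteq> 0})"
      by (rule image_eqI) (use A in auto)
  qed
  moreover have "finite ((\<lambda>(A, B). A \<union> B) ` ({S. f S \<noteq> 0} \<times> {S. g S \<noteq> 0}))"
    using f g by simp
  ultimately have "finite {S. ?h S \<noteq> 0}"
    by (rule finite_subset)
  moreover have "\<forall>S. infinite S \<longrightarrow> ?h S = 0"
    by simp
  ultimately show "finite {S. ?h S \<noteq> 0} \<and> (\<forall>S. infinite S \<longrightarrow> ?h S = 0)"
    by blast
qed

lemma gcoeff_times:
  "gcoeff (f * g) S = (\<Sum>A\<in>Pow S. gsign A (S - A) * gcoeff f A * gcoeff g (S - A))"
  by transfer simp

lemma grassmann_mult_assoc: "(f * g) * h = f * (g * (h :: 'a grassmann))"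
proof (rule gcoeff_eqI)
  fix S :: "'a set" assume S: "finite S"
  let ?F = "\<lambda>A B C. gsign A B * gsign A C * gsign B C * gcoeff f A * gcoeff g B * gcoeff h C"
  have "gcoeff (f * g * h) S = (\<Sum>A\<in>Pow S. \<Sum>B\<in>Pow A. ?F B (A - B) (S - A))"
    unfolding gcoeff_times sum_distrib_left sum_distrib_right
  proof (intro sum.cong refl)
    fix A B assume "A \<in> Pow S" "B \<in> Pow A"
    then have A: "A \<subseteq> S" "B \<subseteq> A" by auto
    have "finite A" using A(1) S by (rule finite_subset)
    moreover have "finite B" using A(2) \<open>finite A\<close> by (rule finite_subset)
    ultimately have "gsign A (S - A) = gsign B (S - A) * gsign (A - B) (S - A)"
      using gsign_Un_left[of B "A - B" "S - A"] A S by (simp add: Un_absorb1)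
    then show "gsign A (S - A) * (gsign B (A - B) * gcoeff f B * gcoeff g (A - B)) *
        gcoeff h (S - A) = ?F B (A - B) (S - A)"
      by (simp add: mult_ac)
  qed
  also have "\<dots> = (\<Sum>(A, B)\<in>Sigma (Pow S) Pow. ?F B (A - B) (S - A))"
    using S by (subst sum.Sigma) (auto intro: finite_subset)
  also have "\<dots> = (\<Sum>(B, C)\<in>Sigma (Pow S) (\<lambda>B. Pow (S - B)). ?F B C (S - B - C))"
  proof (rule sum.reindex_bij_witness[of _ "\<lambda>(B, C). (B \<union> C, B)" "\<lambda>(A, B). (B, A - B)"])
    fix p assume "p \<in> Sigma (Pow S) Pow"
    then obtain A B where p: "p = (A, B)" "A \<subseteq> S" "B \<subseteq> A" by auto
    then have "S - B - (A - B) = S - A" by auto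
    then show "(case case p of (A, B) \<Rightarrow> (B, A - B) of (B, C) \<Rightarrow> ?F B C (S - B - C)) =
        (case p of (A, B) \<Rightarrow> ?F B (A - B) (S - A))"
      using p by simp
  qed (fastforce split: prod.splits)+
  also have "\<dots> = (\<Sum>B\<in>Pow S. \<Sum>C\<in>Pow (S - B). ?F B C (S - B - C))"
    using S by (subst sum.Sigma) (auto intro: finite_subset)
  also have "\<dots> = gcoeff (f * (g * h)) S"
    unfolding gcoeff_times sum_distrib_left sum_distrib_right
  proof (intro sum.cong refl)
    fix B C assume "B \<in> Pow S" "C \<in> Pow (S - B)"
    then have A: "B \<subseteq> S" "C \<subseteq> S - B" by auto
    have "finite B" using A(1) S by (rule finite_subset)
    moreover have "finite C" using A(2) finite_Diff[OF S] by (rule finite_subset)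
    ultimately have "gsign B (S - B) = gsign B C * gsign B (S - B - C)"
      using gsign_Un_right[of B C "S - B - C"] A S by (simp add: Un_absorb1)
    then show "?F B C (S - B - C) = gsign B (S - B) * gcoeff f B *
        (gsign C (S - B - C) * gcoeff g C * gcoeff h (S - B - C))"
      by (simp add: mult_ac)
  qed
  finally show "gcoeff (f * g * h) S = gcoeff (f * (g * h)) S" .
qed

instance
proof
  fix a b c :: "'a grassmann" and r :: real
  show "a * b * c = a * (b * c)" by (rule grassmann_mult_assoc)
  show "(a + b) * c = a * c + b * c" "a * (b + c) = a * b + a * c"
    by (rule gcoeff_eqI,
        simp add: gcoeff_times plus_grassmann.rep_eq sum.distrib algebra_simps)+
  show "r *\<^sub>R a * b = r *\<^sub>R (a * b)" "a * r *\<^sub>R b = r *\<^sub>R (a * b)"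
    by (rule gcoeff_eqI,
        simp add: gcoeff_times scaleR_grassmann.rep_eq sum_distrib_left mult_ac)+
  show "(0 :: 'a grassmann) \<noteq> 1"
    by transfer (auto simp: fun_eq_iff)
  show "1 * a = a"
  proof (rule gcoeff_eqI)
    fix S :: "'a set" assume "finite S"
    then have "gcoeff (1 * a) S = (\<Sum>A\<in>{{}}. gsign A (S - A) * gcoeff 1 A * gcoeff a (S - A))"
      unfolding gcoeff_times by (intro sum.mono_neutral_right) (auto simp: one_grassmann.rep_eq)
    then show "gcoeff (1 * a) S = gcoeff a S" by (simp add: one_grassmann.rep_eq)
  qed
  show "a * 1 = a"
  proof (rule gcoeff_eqI)
    fix S :: "'a set" assume "finite S"
    then have "gcoeff (a * 1) S = (\<Sum>A\<in>{S}. gsign A (S - A) * gcoeff a A * gcoeff 1 (S - A))"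
      unfolding gcoeff_times by (intro sum.mono_neutral_right) (auto simp: one_grassmann.rep_eq)
    then show "gcoeff (a * 1) S = gcoeff a S" by (simp add: one_grassmann.rep_eq)
  qed
qed

end

lift_definition monomial :: "'g set \<Rightarrow> 'g grassmann"
  is "\<lambda>M S. if S = M \<and> finite M then 1 else 0"
  by auto

definition gen :: "'g \<Rightarrow> 'g grassmann" where
  "gen \<xi> = monomial {\<xi>}"

lemma gcoeff_gen: "gcoeff (gen \<xi>) S = (if S = {\<xi>} then 1 else 0)"
  by (simp add: gen_def monomial.rep_eq)

lemma gcoeff_gen_times:
  "gcoeff (gen \<xi> * f) S = (if \<xi> \<in> S then gsign {\<xi>} (S - {\<xi>}) * gcoeff f (S - {\<xi>}) else 0)"
proof (cases "finite S")
  case True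
  then have "gcoeff (gen \<xi> * f) S =
      (\<Sum>A\<in>Pow S \<inter> {{\<xi>}}. gsign A (S - A) * gcoeff (gen \<xi>) A * gcoeff f (S - A))"
    unfolding gcoeff_times by (intro sum.mono_neutral_right) (auto simp: gcoeff_gen)
  also have "Pow S \<inter> {{\<xi>}} = (if \<xi> \<in> S then {{\<xi>}} else {})" by auto
  finally show ?thesis by (simp add: gcoeff_gen)
next
  case False
  then show ?thesis by (simp add: gcoeff_infinite)
qed

text \<open>
  The next three lemmas identify this type as the Grassmann algebra: the generators anticommute
  and square to zero, and the increasing products of generators form a linear basis.
\<close>

lemma gsign_singletons: "gsign {x} {y} = (if y \<lhd> x then - 1 else 1)"
proof -
  have "{(a, b) \<in> {x} \<times> {y}. b \<lhd> a} = (if y \<lhd> x then {(x, y)} else {})" by auto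
  then show ?thesis by (simp add: gsign_def)
qed

lemma gen_anticommute: "gen \<xi> * gen \<eta> = - (gen \<eta> * gen \<xi>)" and gen_square: "gen \<xi> * gen \<xi> = 0"
proof -
  show sq: "gen \<xi> * gen \<xi> = 0" for \<xi> :: 'a
    by (rule gcoeff_eqI) (auto simp: gcoeff_gen_times gcoeff_gen zero_grassmann.rep_eq)
  show "gen \<xi> * gen \<eta> = - (gen \<eta> * gen \<xi>)"
  proof (cases "\<xi> = \<eta>")
    case False
    have sgn: "gsign {\<xi>} {\<eta>} = - gsign {\<eta>} {\<xi>}"
      using False gen_less_linear[of \<xi> \<eta>] gen_less_asym[of \<xi> \<eta>] by (auto simp: gsign_singletons)
    show ?thesis
    proof (rule gcoeff_eqI)
      fix S :: "'a set"
      have *: "\<xi> \<in> S \<and> S - {\<xi>} = {\<eta>} \<longleftrightarrow> S = {\<xi>, \<eta>}" "\<eta> \<in> S \<and> S - {\<eta>} = {\<xi>} \<longleftrightarrow> S = {\<xi>, \<eta>}"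
        using False by auto
      show "gcoeff (gen \<xi> * gen \<eta>) S = gcoeff (- (gen \<eta> * gen \<xi>)) S"
        using * sgn by (auto simp: gcoeff_gen_times gcoeff_gen uminus_grassmann.rep_eq)
    qed
  qed (simp add: sq)
qed

lemma monomial_empty: "monomial {} = 1"
  and monomial_insert:
    "finite S \<Longrightarrow> (\<And>x. x \<in> S \<Longrightarrow> \<xi> \<lhd> x) \<Longrightarrow> monomial (insert \<xi> S) = gen \<xi> * monomial S"
proof -
  show "monomial {} = 1" by transfer auto
  assume S: "finite S" "\<And>x. x \<in> S \<Longrightarrow> \<xi> \<lhd> x"
  then have "\<xi> \<notin> S" and "{(a, b) \<in> {\<xi>} \<times> S. b \<lhd> a} = {}"
    using gen_less_asym by fastforce+
  then have "gsign {\<xi>} S = 1" by (simp only: gsign_def) simp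
  then show "monomial (insert \<xi> S) = gen \<xi> * monomial S"
    using S \<open>\<xi> \<notin> S\<close> by (intro gcoeff_eqI) (auto simp: gcoeff_gen_times monomial.rep_eq)
qed

lemma gcoeff_sum: "gcoeff (\<Sum>i\<in>I. f i) S = (\<Sum>i\<in>I. gcoeff (f i) S)"
  by (induction I rule: infinite_finite_induct)
    (simp_all add: zero_grassmann.rep_eq plus_grassmann.rep_eq)

lemma finite_gcoeff_support: "finite {S. gcoeff f S \<noteq> 0}"
  by transfer blast

lemma monomial_expansion: "f = (\<Sum>S | gcoeff f S \<noteq> 0. gcoeff f S *\<^sub>R monomial S)"
proof (rule gcoeff_eqI)
  fix M :: "'a set" assume "finite M"
  then have "gcoeff (\<Sum>S | gcoeff f S \<noteq> 0. gcoeff f S *\<^sub>R monomial S) M =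
      (\<Sum>S | gcoeff f S \<noteq> 0. if S = M then gcoeff f M else 0)"
    unfolding gcoeff_sum
    by (intro sum.cong) (auto simp: scaleR_grassmann.rep_eq monomial.rep_eq)
  also have "\<dots> = gcoeff f M"
    using finite_gcoeff_support[of f] by simp
  finally show "gcoeff f M = gcoeff (\<Sum>S | gcoeff f S \<noteq> 0. gcoeff f S *\<^sub>R monomial S) M" ..
qed

definition involves :: "'g grassmann \<Rightarrow> 'g \<Rightarrow> bool" where
  "involves f \<xi> \<longleftrightarrow> (\<exists>S. \<xi> \<in> S \<and> gcoeff f S \<noteq> 0)"

text \<open>
  The left derivative, in coordinates; \<open>left_deriv_unique\<close> below is its usual characterization.
\<close>

lift_definition left_deriv :: "'g \<Rightarrow> 'g grassmann \<Rightarrow> 'g grassmann"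
  is "\<lambda>\<xi> f S. if \<xi> \<in> S then 0 else gsign {\<xi>} S * f (insert \<xi> S)"
proof -
  fix \<xi> and f :: "'g set \<Rightarrow> real"
  assume f: "finite {S. f S \<noteq> 0} \<and> (\<forall>S. infinite S \<longrightarrow> f S = 0)"
  let ?h = "\<lambda>S. if \<xi> \<in> S then 0 else gsign {\<xi>} S * f (insert \<xi> S)"
  have "{S. ?h S \<noteq> 0} \<subseteq> (\<lambda>S. S - {\<xi>}) ` {S. f S \<noteq> 0}"
  proof
    fix S assume "S \<in> {S. ?h S \<noteq> 0}"
    then show "S \<in> (\<lambda>S. S - {\<xi>}) ` {S. f S \<noteq> 0}"
      by (intro image_eqI[of _ _ "insert \<xi> S"]) (auto split: if_splits)
  qed
  moreover have "finite ((\<lambda>S. S - {\<xi>}) ` {S. f S \<noteq> 0})"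
    using f by simp
  ultimately have "finite {S. ?h S \<noteq> 0}"
    by (rule finite_subset)
  moreover have "\<forall>S. infinite S \<longrightarrow> ?h S = 0"
    using f by simp
  ultimately show "finite {S. ?h S \<noteq> 0} \<and> (\<forall>S. infinite S \<longrightarrow> ?h S = 0)"
    by blast
qed

lemma linear_left_deriv: "linear (left_deriv \<xi>)"
  by (intro linearI; transfer) (auto simp: fun_eq_iff algebra_simps)

lemma left_deriv_gen_times: "\<not> involves f \<xi> \<Longrightarrow> left_deriv \<xi> (gen \<xi> * f) = f"
proof (rule gcoeff_eqI)
  fix S :: "'a set" assume "\<not> involves f \<xi>"
  then show "gcoeff (left_deriv \<xi> (gen \<xi> * f)) S = gcoeff f S"
    by (auto simp: left_deriv.rep_eq gcoeff_gen_times involves_def mult.assoc [symmetric])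
qed

lemma left_deriv_eq_0: "\<not> involves f \<xi> \<Longrightarrow> left_deriv \<xi> f = 0"
  by (rule gcoeff_eqI) (auto simp: left_deriv.rep_eq involves_def zero_grassmann.rep_eq)

lemma not_involves_left_deriv: "\<not> involves (left_deriv \<xi> f) \<xi>"
  by (auto simp: involves_def left_deriv.rep_eq)

lemma left_deriv_decompose: "\<not> involves (f - gen \<xi> * left_deriv \<xi> f) \<xi>"
  by (auto simp: involves_def minus_grassmann.rep_eq gcoeff_gen_times left_deriv.rep_eq insert_absorb
      mult.assoc [symmetric])

theorem left_deriv_unique:
  "linear D \<and> (\<forall>f. \<not> involves f \<xi> \<longrightarrow> D (gen \<xi> * f) = f \<and> D f = 0) \<longleftrightarrow> D = left_deriv \<xi>"
proof
  assume D: "linear D \<and> (\<forall>f. \<not> involves f \<xi> \<longrightarrow> D (gen \<xi> * f) = f \<and> D f = 0)"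
  show "D = left_deriv \<xi>"
  proof
    fix f
    have "D f = D (gen \<xi> * left_deriv \<xi> f) + D (f - gen \<xi> * left_deriv \<xi> f)"
      using D by (simp add: linear_add [symmetric])
    then show "D f = left_deriv \<xi> f"
      using D not_involves_left_deriv left_deriv_decompose by (metis add.right_neutral)
  qed
qed (simp add: linear_left_deriv left_deriv_gen_times left_deriv_eq_0)

text \<open>
  The exponential series of a nilpotent element, which is all that is needed here;
  \<^const>\<open>Sum_any\<close> is the sum over the indices with nonzero terms.
\<close>

definition gexp :: "'g grassmann \<Rightarrow> 'g grassmann" where
  "gexp f = Sum_any (\<lambda>n. f ^ n /\<^sub>R fact n)"

text \<open>
  The product over a finite set of pairwise commuting elements of a ring that need not be
  commutative (so that \<^const>\<open>prod\<close> is not available).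
\<close>

definition cprod :: "('i \<Rightarrow> 'b :: monoid_mult) \<Rightarrow> 'i set \<Rightarrow> 'b" where
  "cprod f I = Finite_Set.fold (\<lambda>i x. f i * x) 1 I"


section \<open>Graphs and uniform spanning trees\<close>

text \<open>A graph is given by its vertex set \<open>W\<close> and its adjacency relation.\<close>

definition simple_graph :: "'a set \<Rightarrow> ('a \<Rightarrow> 'a \<Rightarrow> bool) \<Rightarrow> bool" where
  "simple_graph W adj \<longleftrightarrow> (\<forall>u v. adj u v \<longrightarrow> u \<in> W \<and> v \<in> W \<and> u \<noteq> v \<and> adj v u)"

definition locally_finite_graph :: "'a set \<Rightarrow> ('a \<Rightarrow> 'a \<Rightarrow> bool) \<Rightarrow> bool" where
  "locally_finite_graph W adj \<longleftrightarrow> (\<forall>u\<in>W. finite {w. adj u w})"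

definition connected_graph :: "'a set \<Rightarrow> ('a \<Rightarrow> 'a \<Rightarrow> bool) \<Rightarrow> bool" where
  "connected_graph W adj \<longleftrightarrow> W \<noteq> {} \<and> (\<forall>u\<in>W. \<forall>v\<in>W. adj\<^sup>*\<^sup>* u v)"

definition edges_meeting :: "('a \<Rightarrow> 'a \<Rightarrow> bool) \<Rightarrow> 'a set \<Rightarrow> 'a set set" where
  "edges_meeting adj \<Lambda> = {{u, v} | u v. u \<in> \<Lambda> \<and> adj u v}"

definition edges_at :: "('a \<Rightarrow> 'a \<Rightarrow> bool) \<Rightarrow> 'a set \<Rightarrow> 'a \<Rightarrow> 'a set set" where
  "edges_at adj \<Lambda> v = {e \<in> edges_meeting adj \<Lambda>. v \<in> e}"

text \<open>\<open>tail e\<close> and \<open>tip e\<close> are written \<open>e\<^sup>-\<close> and \<open>e\<^sup>+\<close> in the literature.\<close>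

definition orientation :: "'a set set \<Rightarrow> ('a set \<Rightarrow> 'a) \<Rightarrow> ('a set \<Rightarrow> 'a) \<Rightarrow> bool" where
  "orientation E tail tip \<longleftrightarrow> (\<forall>e\<in>E. e = {tail e, tip e})"

definition good_set :: "('a \<Rightarrow> 'a \<Rightarrow> bool) \<Rightarrow> 'a set \<Rightarrow> 'a set \<Rightarrow> bool" where
  "good_set adj \<Lambda> V \<longleftrightarrow> V \<subseteq> \<Lambda> \<and> (\<forall>u\<in>V. \<forall>v\<in>V. \<not> adj u v)"

text \<open>
  Spanning trees of a multigraph with vertex set \<open>N\<close> and edge set \<open>E\<close>, where \<open>ends e\<close> is the set of
  endpoints of \<open>e\<close>. In a cycle, two parallel edges count as a cycle of length 2.
\<close>

definition multigraph_connected :: "'n set \<Rightarrow> 'e set \<Rightarrow> ('e \<Rightarrow> 'n set) \<Rightarrow> bool" where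
  "multigraph_connected N T ends \<longleftrightarrow>
     N \<noteq> {} \<and> (\<forall>x\<in>N. \<forall>y\<in>N. (\<lambda>x y. \<exists>e\<in>T. ends e = {x, y})\<^sup>*\<^sup>* x y)"

definition multigraph_cycle :: "('e \<Rightarrow> 'n set) \<Rightarrow> 'n list \<Rightarrow> 'e list \<Rightarrow> bool" where
  "multigraph_cycle ends xs es \<longleftrightarrow>
     es \<noteq> [] \<and> length xs = length es \<and> distinct xs \<and> distinct es \<and>
     (\<forall>i < length es. ends (es ! i) = {xs ! i, xs ! (Suc i mod length es)})"

definition spanning_tree :: "'n set \<Rightarrow> 'e set \<Rightarrow> ('e \<Rightarrow> 'n set) \<Rightarrow> 'e set \<Rightarrow> bool" where
  "spanning_tree N E ends T \<longleftrightarrow>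
     T \<subseteq> E \<and> multigraph_connected N T ends \<and>
     \<not> (\<exists>xs es. set es \<subseteq> T \<and> multigraph_cycle ends xs es)"

text \<open>In the wired graph, \<^const>\<open>None\<close> is the vertex to which all vertices outside \<open>\<Lambda>\<close> are identified.\<close>

definition wire :: "'a set \<Rightarrow> 'a \<Rightarrow> 'a option" where
  "wire \<Lambda> v = (if v \<in> \<Lambda> then Some v else None)"

definition wired_spanning_trees :: "'a set \<Rightarrow> ('a \<Rightarrow> 'a \<Rightarrow> bool) \<Rightarrow> 'a set \<Rightarrow> 'a set set set" where
  "wired_spanning_trees W adj \<Lambda> =
     {T. spanning_tree (wire \<Lambda> ` W) (edges_meeting adj \<Lambda>) (\<lambda>e. wire \<Lambda> ` e) T}"

definition ust :: "'a set \<Rightarrow> ('a \<Rightarrow> 'a \<Rightarrow> bool) \<Rightarrow> 'a set \<Rightarrow> 'a set set pmf" where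
  "ust W adj \<Lambda> = pmf_of_set (wired_spanning_trees W adj \<Lambda>)"

definition tree_degree :: "('a \<Rightarrow> 'a \<Rightarrow> bool) \<Rightarrow> 'a set \<Rightarrow> 'a \<Rightarrow> 'a set set \<Rightarrow> nat" where
  "tree_degree adj \<Lambda> v T = (\<Sum>e\<in>edges_at adj \<Lambda> v. of_bool (e \<in> T))"

definition degree_indicator :: "('a \<Rightarrow> 'a \<Rightarrow> bool) \<Rightarrow> 'a set \<Rightarrow> 'a \<Rightarrow> nat \<Rightarrow> 'a set set \<Rightarrow> real" where
  "degree_indicator adj \<Lambda> v k T = of_bool (tree_degree adj \<Lambda> v T = k)"


section \<open>The fermionic Gaussian free field\<close>

definition laplacian :: "('a \<Rightarrow> 'a \<Rightarrow> bool) \<Rightarrow> 'a \<Rightarrow> 'a \<Rightarrow> real" where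
  "laplacian adj u v =
     (if u = v then - real (card {w. adj u w}) else if adj u v then 1 else 0)"

text \<open>The determinant of a matrix indexed by a finite set (cf. \<^const>\<open>det\<close>, indexed by a type).\<close>

definition det_on :: "'a set \<Rightarrow> ('a \<Rightarrow> 'a \<Rightarrow> real) \<Rightarrow> real" where
  "det_on I A = (\<Sum>p | p permutes I. of_int (sign p) * (\<Prod>i\<in>I. A i (p i)))"

datatype 'a fermion = Psi 'a | PsiBar 'a

text \<open>
  The algebra \<open>\<Omega>\<^sup>2\<^sup>\<Lambda>\<close> is the set of elements which involve only \<open>Psi v\<close> and \<open>PsiBar v\<close> with \<open>v \<in> \<Lambda>\<close>.
\<close>

definition fermion_algebra :: "'a set \<Rightarrow> 'a fermion grassmann set" where
  "fermion_algebra \<Lambda> = {P. \<forall>\<xi>. involves P \<xi> \<longrightarrow> \<xi> \<in> Psi ` \<Lambda> \<union> PsiBar ` \<Lambda>}"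

definition psi :: "'a set \<Rightarrow> 'a \<Rightarrow> 'a fermion grassmann" where
  "psi \<Lambda> v = (if v \<in> \<Lambda> then gen (Psi v) else 0)"

definition psibar :: "'a set \<Rightarrow> 'a \<Rightarrow> 'a fermion grassmann" where
  "psibar \<Lambda> v = (if v \<in> \<Lambda> then gen (PsiBar v) else 0)"

text \<open>The operators composed here commute, so the order of the composition does not matter.\<close>

definition berezin :: "'a set \<Rightarrow> 'a fermion grassmann \<Rightarrow> 'a fermion grassmann" where
  "berezin \<Lambda> P = Finite_Set.fold (\<lambda>v Q. left_deriv (PsiBar v) (left_deriv (Psi v) Q)) P \<Lambda>"

lemma left_deriv_anticommute: "left_deriv \<xi> (left_deriv \<eta> f) = - left_deriv \<eta> (left_deriv \<xi> f)"
proof (rule gcoeff_eqI)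
  fix S :: "'a set" assume S: "finite S"
  show "gcoeff (left_deriv \<xi> (left_deriv \<eta> f)) S = gcoeff (- left_deriv \<eta> (left_deriv \<xi> f)) S"
  proof (cases "\<xi> = \<eta> \<or> \<xi> \<in> S \<or> \<eta> \<in> S")
    case True
    then show ?thesis by (auto simp: left_deriv.rep_eq uminus_grassmann.rep_eq)
  next
    case False
    have "gsign {\<eta>} ({\<xi>} \<union> S) = gsign {\<eta>} {\<xi>} * gsign {\<eta>} S"
      "gsign {\<xi>} ({\<eta>} \<union> S) = gsign {\<xi>} {\<eta>} * gsign {\<xi>} S"
      using False S by (intro gsign_Un_right; simp)+
    moreover have "gsign {\<xi>} {\<eta>} = - gsign {\<eta>} {\<xi>}"
      using False gen_less_linear[of \<xi> \<eta>] gen_less_asym[of \<xi> \<eta>] by (auto simp: gsign_singletons)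
    ultimately show ?thesis
      using False by (auto simp: left_deriv.rep_eq uminus_grassmann.rep_eq insert_commute mult_ac)
  qed
qed

lemma involves_left_deriv: "involves (left_deriv \<xi> f) \<eta> \<Longrightarrow> involves f \<eta> \<and> \<eta> \<noteq> \<xi>"
  by (auto simp: involves_def left_deriv.rep_eq split: if_splits)

lemma left_deriv_minus: "left_deriv \<xi> (- f) = - left_deriv \<xi> f"
  by (rule linear_neg[OF linear_left_deriv])

lemma berezin_empty [simp]: "berezin {} P = P"
  by (simp add: berezin_def)

lemma berezin_insert:
  assumes "finite \<Lambda>" "v \<notin> \<Lambda>"
  shows "berezin (insert v \<Lambda>) P = left_deriv (PsiBar v) (left_deriv (Psi v) (berezin \<Lambda> P))"
proof -
  let ?D = "\<lambda>v (Q :: 'a fermion grassmann). left_deriv (PsiBar v) (left_deriv (Psi v) Q)"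
  have "?D u (?D w Q) = ?D w (?D u Q)" for u w Q
  proof -
    have "?D u (?D w Q) = left_deriv (PsiBar u) (- left_deriv (PsiBar w) (left_deriv (Psi u) (left_deriv (Psi w) Q)))"
      by (simp add: left_deriv_anticommute[of "Psi u" "PsiBar w"])
    also have "\<dots> = left_deriv (PsiBar w) (left_deriv (PsiBar u) (left_deriv (Psi u) (left_deriv (Psi w) Q)))"
      by (simp add: left_deriv_minus left_deriv_anticommute[of "PsiBar u" "PsiBar w"])
    also have "\<dots> = left_deriv (PsiBar w) (left_deriv (PsiBar u) (- left_deriv (Psi w) (left_deriv (Psi u) Q)))"
      by (simp add: left_deriv_anticommute[of "Psi u" "Psi w"])
    also have "\<dots> = ?D w (?D u Q)"
      by (simp add: left_deriv_minus left_deriv_anticommute[of "PsiBar u" "Psi w"])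
    finally show ?thesis .
  qed
  then interpret comp_fun_commute ?D
    by unfold_locales (simp add: fun_eq_iff)
  show ?thesis
    using assms by (simp add: berezin_def)
qed

lemma involves_berezin:
  assumes "finite \<Lambda>" "involves (berezin \<Lambda> P) \<xi>"
  shows "involves P \<xi> \<and> \<xi> \<notin> Psi ` \<Lambda> \<union> PsiBar ` \<Lambda>"
  using assms
  by (induction \<Lambda> rule: finite_induct) (auto simp: berezin_insert dest!: involves_left_deriv)

lemma berezin_scalar:
  assumes "finite \<Lambda>" "P \<in> fermion_algebra \<Lambda>"
  shows "berezin \<Lambda> P = of_real (gcoeff (berezin \<Lambda> P) {})"
proof (rule gcoeff_eqI)
  fix S :: "'a fermion set"
  have "\<not> involves (berezin \<Lambda> P) \<xi>" for \<xi>
    using assms involves_berezin unfolding fermion_algebra_def by blast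
  then have "S \<noteq> {} \<Longrightarrow> gcoeff (berezin \<Lambda> P) S = 0"
    by (auto simp: involves_def)
  then show "gcoeff (berezin \<Lambda> P) S = gcoeff (of_real (gcoeff (berezin \<Lambda> P) {})) S"
    by (auto simp: of_real_def scaleR_grassmann.rep_eq one_grassmann.rep_eq)
qed

text \<open>
  For \<open>P\<close> in \<^term>\<open>fermion_algebra \<Lambda>\<close>, the iterated derivative is a multiple of \<open>1\<close> (see
  \<open>berezin_scalar\<close>); \<open>gcoeff _ {}\<close> reads off the real number.
\<close>

definition fgff_state :: "('a \<Rightarrow> 'a \<Rightarrow> bool) \<Rightarrow> 'a set \<Rightarrow> 'a fermion grassmann \<Rightarrow> real" where
  "fgff_state adj \<Lambda> P =
     1 / det_on \<Lambda> (\<lambda>u v. - laplacian adj u v) *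
     gcoeff (berezin \<Lambda>
       (gexp (\<Sum>u\<in>\<Lambda>. \<Sum>v\<in>\<Lambda>. (- laplacian adj u v) *\<^sub>R (psi \<Lambda> u * psibar \<Lambda> v)) * P)) {}"

definition zeta :: "'a set \<Rightarrow> ('a set \<Rightarrow> 'a) \<Rightarrow> ('a set \<Rightarrow> 'a) \<Rightarrow> 'a set \<Rightarrow> 'a fermion grassmann" where
  "zeta \<Lambda> tail tip e =
     (psi \<Lambda> (tip e) - psi \<Lambda> (tail e)) * (psibar \<Lambda> (tip e) - psibar \<Lambda> (tail e))"

definition X_field :: "('a \<Rightarrow> 'a \<Rightarrow> bool) \<Rightarrow> 'a set \<Rightarrow> ('a set \<Rightarrow> 'a) \<Rightarrow> ('a set \<Rightarrow> 'a) \<Rightarrow>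
    'a \<Rightarrow> nat \<Rightarrow> 'a fermion grassmann" where
  "X_field adj \<Lambda> tail tip v k =
     (\<Sum>\<E> | \<E> \<subseteq> edges_at adj \<Lambda> v \<and> card \<E> = k. cprod (zeta \<Lambda> tail tip) \<E>)"

definition Y_field :: "('a \<Rightarrow> 'a \<Rightarrow> bool) \<Rightarrow> 'a set \<Rightarrow> ('a set \<Rightarrow> 'a) \<Rightarrow> ('a set \<Rightarrow> 'a) \<Rightarrow>
    'a \<Rightarrow> 'a fermion grassmann" where
  "Y_field adj \<Lambda> tail tip v = cprod (\<lambda>e. 1 - zeta \<Lambda> tail tip e) (edges_at adj \<Lambda> v)"

end

theory Submission
  imports Defs
begin

text \<open>
  The quadratic form of \<open>- \<Delta>\<close> is the sum of the \<open>\<zeta>(e)\<close>, which are central and square to \<open>0\<close>, so its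
  exponential is the product of the \<open>1 + \<zeta>(e)\<close>, that is, the sum over all edge sets \<open>T\<close> of
  \<open>\<zeta>(T) = \<Prod>e\<in>T. \<zeta>(e)\<close>. As \<open>(1 + \<zeta>(e)) (1 - \<zeta>(e)) = 1\<close>, multiplying by \<open>Y v\<close> removes the edges at \<open>v\<close>
  and multiplying by \<open>X v k\<close> puts back exactly \<open>k\<close> of them; for a good set these edge sets are disjoint.
  It remains to see that the Berezin integral of \<open>\<zeta>(T)\<close> is \<open>1\<close> if \<open>T\<close> is a spanning tree of the wired
  graph and \<open>0\<close> otherwise. If no edge of \<open>T\<close> joins \<open>\<Lambda>\<close> to its complement, then \<open>\<zeta>(T)\<close> is invariant under
  translating all \<open>\<psi>\<close> simultaneously, and the integral vanishes. If \<open>e\<close> is such an edge, with endpoint \<open>v\<close> in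
  \<open>\<Lambda>\<close>, then \<open>\<zeta>(e)\<close> is the product of the two generators at \<open>v\<close>, and integrating them out contracts \<open>e\<close>.
  With the Gaussian integral for \<open>det (- \<Delta>)\<close> this also gives the number of spanning trees.
\<close>

section \<open>The center of a ring\<close>

text \<open>Elements of even degree commute with everything. Placing them in the center makes the
  calculus of sums, products and powers in a commutative ring available, although the Grassmann
  algebra is not commutative.\<close>

typedef (overloaded) 'a center = "{c :: 'a :: ring_1. \<forall>x. c * x = x * c}"
  morphisms of_center to_center
  by (rule exI[of _ 1]) simp

setup_lifting type_definition_center

instantiation center :: (ring_1) comm_ring_1
begin

lift_definition zero_center :: "'a center" is 0 by simp
lift_definition one_center :: "'a center" is 1 by simp
lift_definition plus_center :: "'a center \<Rightarrow> 'a center \<Rightarrow> 'a center" is "(+)"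
  by (simp add: distrib_left distrib_right)
lift_definition minus_center :: "'a center \<Rightarrow> 'a center \<Rightarrow> 'a center" is "(-)"
  by (simp add: left_diff_distrib right_diff_distrib)
lift_definition uminus_center :: "'a center \<Rightarrow> 'a center" is uminus
  by simp
lift_definition times_center :: "'a center \<Rightarrow> 'a center \<Rightarrow> 'a center" is "(*)"
  by (metis mult.assoc)

instance
proof
  fix a b c :: "'a center"
  show "a * b * c = a * (b * c)" by transfer (rule mult.assoc)
  show "a * b = b * a" by transfer blast
  show "1 * a = a" by transfer simp
  show "a + b + c = a + (b + c)" by transfer (rule add.assoc)
  show "a + b = b + a" by transfer (rule add.commute)
  show "0 + a = a" by transfer simp
  show "- a + a = 0" by transfer simp
  show "a - b = a + - b" by transfer simp
  show "(a + b) * c = a * c + b * c" by transfer (rule distrib_right)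
  show "(0 :: 'a center) \<noteq> 1" by transfer simp
qed

end

lemmas of_center_simps [simp] =
  zero_center.rep_eq one_center.rep_eq plus_center.rep_eq minus_center.rep_eq
  uminus_center.rep_eq times_center.rep_eq

lemma of_center_commute: "of_center c * x = x * of_center c"
  using of_center[of c] by simp

lemma of_center_sum: "of_center (\<Sum>i\<in>I. f i) = (\<Sum>i\<in>I. of_center (f i))"
  by (induction I rule: infinite_finite_induct) simp_all

lemma of_center_power: "of_center (c ^ n) = of_center c ^ n"
  by (induction n) simp_all

lemma of_center_of_nat: "of_center (of_nat n) = of_nat n"
  by (induction n) simp_all

lemma of_center_to_center: "(\<And>x. c * x = x * c) \<Longrightarrow> of_center (to_center c) = c"
  by (rule to_center_inverse) simp

text \<open>The fold behind \<open>cprod\<close> needs commuting factors, which centrality provides.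
  Products of edge variables can thus be handled by \<open>prod\<close> in the center.\<close>

lemma cprod_of_center: "cprod (\<lambda>i. of_center (f i)) I = of_center (\<Prod>i\<in>I. f i)"
proof (induction I rule: infinite_finite_induct)
  case (insert i I)
  interpret comp_fun_commute "\<lambda>i x. of_center (f i) * x"
    by unfold_locales
      (simp add: fun_eq_iff mult.assoc [symmetric] mult.commute flip: times_center.rep_eq)
  show ?case
    using insert by (simp add: cprod_def)
qed (simp_all add: cprod_def)

section \<open>Expansions in elements of square zero\<close>

lemma sum_insert_subsets:
  fixes z :: "'i \<Rightarrow> 'b :: comm_ring_1"
  assumes "finite I" "i \<notin> I"
  shows "(\<Sum>T | T \<subseteq> insert i I \<and> card T = n. prod z T) =
    (\<Sum>T | T \<subseteq> I \<and> card T = n. prod z T) +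
    (if n = 0 then 0 else z i * (\<Sum>T | T \<subseteq> I \<and> card T = n - 1. prod z T))"
proof -
  \<comment> \<open>A subset of size \<open>n\<close> avoids \<open>i\<close> or arises by adding
    \<open>i\<close> to one of size \<open>n - 1\<close>. The case \<open>n = 0\<close> is separate,
    as subtraction truncates at 0.\<close>
  have *: "{T. T \<subseteq> insert i I \<and> card T = n} = {T. T \<subseteq> I \<and> card T = n} \<union>
      (if n = 0 then {} else insert i ` {T. T \<subseteq> I \<and> card T = n - 1})" (is "?A = ?B \<union> ?C")
  proof (rule equalityI; rule subsetI)
    fix T assume T: "T \<in> ?A"
    then have "finite T" using assms by (auto intro: finite_subset)
    show "T \<in> ?B \<union> ?C"
    proof (cases "i \<in> T")
      case True
      then have "T - {i} \<in> {T. T \<subseteq> I \<and> card T = n - 1}" "n \<noteq> 0"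
        using T \<open>finite T\<close> by (auto simp: card_gt_0_iff)
      moreover have "T = insert i (T - {i})"
        using True by blast
      ultimately show ?thesis
        by (simp only: if_False) blast
    qed (use T in auto)
  next
    fix T assume "T \<in> ?B \<union> ?C"
    then show "T \<in> ?A"
      using assms by (auto split: if_splits simp: card_insert_if finite_subset)
  qed
  have fin: "finite {T. T \<subseteq> I \<and> card T = m}" for m
    using assms by simp
  have inj: "inj_on (insert i) {T. T \<subseteq> I \<and> card T = n - 1}"
    using assms by (intro inj_onI) (metis (lifting) CollectD Diff_insert_absorb subsetD)
  have "(\<Sum>T\<in>insert i ` {T. T \<subseteq> I \<and> card T = n - 1}. prod z T) =
      z i * (\<Sum>T | T \<subseteq> I \<and> card T = n - 1. prod z T)"
    unfolding sum.reindex[OF inj] sum_distrib_left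
  proof (intro sum.cong refl)
    fix T assume "T \<in> {T. T \<subseteq> I \<and> card T = n - 1}"
    then show "(prod z \<circ> insert i) T = z i * prod z T"
      using assms by (auto simp: finite_subset subset_iff intro!: prod.insert)
  qed
  then show ?thesis
    unfolding * using fin assms by (subst sum.union_disjoint) auto
qed

text \<open>The binomial formula, cut off after the linear term because all higher powers of
  \<open>z\<close> vanish.\<close>

lemma power_add_square_zero:
  fixes x z :: "'b :: comm_ring_1"
  assumes "z * z = 0"
  shows "(x + z) ^ n = x ^ n + (if n = 0 then 0 else of_nat n * z * x ^ (n - 1))"
proof (induction n)
  case (Suc n)
  have *: "z * (z * y) = 0" for y
    using assms by (metis mult.assoc mult_zero_left)
  show ?case
    using Suc assms by (cases n) (simp_all add: algebra_simps *)
qed simp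

text \<open>When the power is expanded, only products of distinct factors survive, and each of them
  appears in \<open>fact n\<close> orders.\<close>

lemma power_sum_square_zero:
  fixes z :: "'i \<Rightarrow> 'b :: comm_ring_1"
  assumes "finite I" "\<And>i. i \<in> I \<Longrightarrow> z i * z i = 0"
  shows "(\<Sum>i\<in>I. z i) ^ n = of_nat (fact n) * (\<Sum>T | T \<subseteq> I \<and> card T = n. prod z T)"
  using assms
proof (induction I arbitrary: n rule: finite_induct)
  case empty
  have "{T :: 'i set. T \<subseteq> {} \<and> card T = n} = (if n = 0 then {{}} else {})"
    by auto
  then show ?case
    by (cases "n = 0") (simp_all only:, simp_all add: zero_power)
next
  case (insert i I)
  have "sum z (insert i I) ^ n = (sum z I + z i) ^ n"
    using insert by (simp add: add.commute)
  also have "\<dots> = sum z I ^ n + (if n = 0 then 0 else of_nat n * z i * sum z I ^ (n - 1))"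
    using insert by (intro power_add_square_zero) auto
  also have "\<dots> = of_nat (fact n) * (\<Sum>T | T \<subseteq> insert i I \<and> card T = n. prod z T)"
  proof -
    have IH: "sum z I ^ m = of_nat (fact m) * (\<Sum>T | T \<subseteq> I \<and> card T = m. prod z T)" for m
      using insert by simp
    show ?thesis
      unfolding IH sum_insert_subsets[OF insert.hyps]
      by (cases n) (simp_all add: algebra_simps)
  qed
  finally show ?case .
qed

text \<open>The factorial from \<open>power_sum_square_zero\<close> cancels the one in the
  exponential series, and summing over all sizes leaves every subset once.\<close>

lemma gexp_of_center_sum:
  fixes z :: "'i \<Rightarrow> 'g grassmann center"
  assumes "finite I" "\<And>i. i \<in> I \<Longrightarrow> z i * z i = 0"
  shows "gexp (of_center (\<Sum>i\<in>I. z i)) = of_center (\<Sum>T\<in>Pow I. prod z T)"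
proof -
  have *: "of_center (\<Sum>i\<in>I. z i) ^ n /\<^sub>R fact n =
      of_center (\<Sum>T | T \<subseteq> I \<and> card T = n. prod z T)" for n
  proof -
    have "of_center (\<Sum>i\<in>I. z i) ^ n =
        of_nat (fact n) * of_center (\<Sum>T | T \<subseteq> I \<and> card T = n. prod z T)"
      using power_sum_square_zero[OF assms, where n = n]
      by (simp only: of_center_power [symmetric] times_center.rep_eq of_center_of_nat)
    also have "\<dots> = fact n *\<^sub>R of_center (\<Sum>T | T \<subseteq> I \<and> card T = n. prod z T)"
      by (simp add: scaleR_conv_of_real)
    finally show ?thesis by simp
  qed
  \<comment> \<open>There are no subsets larger than \<open>card I\<close>, so the series is a
    finite sum.\<close>
  have "{n. of_center (\<Sum>T | T \<subseteq> I \<and> card T = n. prod z T) \<noteq> 0} \<subseteq> {..card I}"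
  proof
    fix n assume n: "n \<in> {n. of_center (\<Sum>T | T \<subseteq> I \<and> card T = n. prod z T) \<noteq> 0}"
    have "{T. T \<subseteq> I \<and> card T = n} \<noteq> {}"
    proof
      assume "{T. T \<subseteq> I \<and> card T = n} = {}"
      then have "(\<Sum>T | T \<subseteq> I \<and> card T = n. prod z T) = 0"
        by (simp only: sum.empty)
      then show False using n by simp
    qed
    then show "n \<in> {..card I}"
      using card_mono[OF assms(1)] by auto
  qed
  then have "gexp (of_center (\<Sum>i\<in>I. z i)) =
      (\<Sum>n\<le>card I. of_center (\<Sum>T | T \<subseteq> I \<and> card T = n. prod z T))"
    unfolding gexp_def * by (intro Sum_any.expand_superset) auto
  also have "\<dots> = of_center (\<Sum>n\<le>card I. \<Sum>T | T \<in> Pow I \<and> card T = n. prod z T)"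
    by (simp add: of_center_sum)
  also have "\<dots> = of_center (\<Sum>T\<in>Pow I. prod z T)"
    using assms(1) by (subst sum.group) (auto intro: card_mono)
  finally show ?thesis .
qed

text \<open>A subset \<open>T\<close> of \<open>E\<close> is the same as the pair of
  \<open>T - B\<close> and \<open>T \<inter> B\<close>, which can be chosen independently, and the
  product splits accordingly.\<close>

lemma sum_subsets_split:
  fixes z :: "'i \<Rightarrow> 'b :: comm_ring_1"
  assumes "finite E" "B \<subseteq> E"
  shows "(\<Sum>T | T \<subseteq> E \<and> P (T - B) \<and> Q (T \<inter> B). prod z T) =
    (\<Sum>T | T \<subseteq> E - B \<and> P T. prod z T) * (\<Sum>T | T \<subseteq> B \<and> Q T. prod z T)"
proof -
  have "(\<Sum>T | T \<subseteq> E - B \<and> P T. prod z T) * (\<Sum>T | T \<subseteq> B \<and> Q T. prod z T) =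
      (\<Sum>(S, T)\<in>{S. S \<subseteq> E - B \<and> P S} \<times> {T. T \<subseteq> B \<and> Q T}. prod z S * prod z T)"
    by (simp add: sum_product sum.cartesian_product)
  also have "\<dots> = (\<Sum>T | T \<subseteq> E \<and> P (T - B) \<and> Q (T \<inter> B). prod z T)"
  proof (rule sum.reindex_bij_witness[of _ "\<lambda>T. (T - B, T \<inter> B)" "\<lambda>(S, T). S \<union> T"])
    fix p assume p: "p \<in> {S. S \<subseteq> E - B \<and> P S} \<times> {T. T \<subseteq> B \<and> Q T}"
    then obtain S T where ST: "p = (S, T)" "S \<subseteq> E - B" "P S" "T \<subseteq> B" "Q T"
      by auto
    then have eq: "(S \<union> T) - B = S" "(S \<union> T) \<inter> B = T"
      by auto
    show "((case p of (S, T) \<Rightarrow> S \<union> T) - B, (case p of (S, T) \<Rightarrow> S \<union> T) \<inter> B) = p"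
      using eq by (simp add: ST(1))
    show "(case p of (S, T) \<Rightarrow> S \<union> T) \<in> {T. T \<subseteq> E \<and> P (T - B) \<and> Q (T \<inter> B)}"
      using ST eq assms by auto
    have "finite S" "finite T" "S \<inter> T = {}"
      using ST assms by (auto intro: finite_subset)
    then show "prod z (case p of (S, T) \<Rightarrow> S \<union> T) = (case p of (S, T) \<Rightarrow> prod z S * prod z T)"
      using ST(1) by (simp add: prod.union_disjoint)
  qed (use assms in auto)
  finally show ?thesis ..
qed

lemma prod_one_plus:
  fixes z :: "'i \<Rightarrow> 'b :: comm_ring_1"
  assumes "finite I"
  shows "(\<Prod>i\<in>I. 1 + z i) = (\<Sum>T | T \<subseteq> I. prod z T)"
  using prod_add[OF assms, of z "\<lambda>_. 1"] by (simp add: Pow_def add.commute)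

section \<open>Derivatives and Berezin integration\<close>

lemma involves_0 [simp]: "\<not> involves 0 \<xi>"
  by (simp add: involves_def zero_grassmann.rep_eq)

lemma involves_1 [simp]: "\<not> involves 1 \<xi>"
  by (auto simp: involves_def one_grassmann.rep_eq)

lemma involves_gen [simp]: "involves (gen \<eta>) \<xi> \<longleftrightarrow> \<xi> = \<eta>"
  by (auto simp: involves_def gcoeff_gen)

lemma involves_scaleR: "involves (c *\<^sub>R f) \<xi> \<Longrightarrow> involves f \<xi>"
  by (auto simp: involves_def scaleR_grassmann.rep_eq)

lemma involves_diff: "involves (f - g) \<xi> \<Longrightarrow> involves f \<xi> \<or> involves g \<xi>"
  by (force simp: involves_def minus_grassmann.rep_eq)

lemma involves_times:
  assumes "involves (f * g) \<xi>"
  shows "involves f \<xi> \<or> involves g \<xi>"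
proof -
  obtain S where S: "\<xi> \<in> S" "gcoeff (f * g) S \<noteq> 0"
    using assms by (auto simp: involves_def)
  then obtain A where "gcoeff f A \<noteq> 0" "gcoeff g (S - A) \<noteq> 0"
    unfolding gcoeff_times by (metis (no_types, lifting) mult_eq_0_iff sum.neutral)
  moreover have "\<xi> \<in> A \<or> \<xi> \<in> S - A"
    using S(1) by simp
  ultimately show ?thesis
    unfolding involves_def by meson
qed

lemma involves_sum: "involves (\<Sum>i\<in>I. f i) \<xi> \<Longrightarrow> \<exists>i\<in>I. involves (f i) \<xi>"
  unfolding involves_def gcoeff_sum by (meson sum.not_neutral_contains_not_neutral)

text \<open>The graded Leibniz rule: moving the derivative past a generator costs a sign. It follows
  by writing \<open>f = ?h + gen \<xi> * ?g\<close> with \<open>?h\<close> and \<open>?g\<close>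
  free of \<open>\<xi>\<close>.\<close>

lemma left_deriv_gen_mult:
  "left_deriv \<xi> (gen \<eta> * f) = (if \<eta> = \<xi> then f else 0) - gen \<eta> * left_deriv \<xi> f"
proof -
  let ?g = "left_deriv \<xi> f" and ?h = "f - gen \<xi> * left_deriv \<xi> f"
  have nh: "\<not> involves ?h \<xi>" by (rule left_deriv_decompose)
  have ng: "\<not> involves ?g \<xi>" by (rule not_involves_left_deriv)
  have sq: "gen x * (gen x * y) = 0" for x :: 'a and y
    by (simp add: gen_square flip: mult.assoc)
  show ?thesis
  proof (cases "\<eta> = \<xi>")
    case True
    have "gen \<xi> * f = gen \<xi> * ?h"
      by (simp add: right_diff_distrib sq)
    then show ?thesis
      using True nh by (simp add: left_deriv_gen_times)
  next
    case False
    have "gen \<eta> * f = gen \<eta> * ?h - gen \<xi> * (gen \<eta> * ?g)"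
      by (simp add: right_diff_distrib gen_anticommute[of \<xi> \<eta>] flip: mult.assoc)
    moreover have "\<not> involves (gen \<eta> * ?h) \<xi>" "\<not> involves (gen \<eta> * ?g) \<xi>"
      using False nh ng by (auto dest!: involves_times)
    ultimately show ?thesis
      using False
      by (simp add: linear_diff[OF linear_left_deriv] left_deriv_gen_times left_deriv_eq_0)
  qed
qed

lemma left_deriv_1 [simp]: "left_deriv \<xi> 1 = 0"
  by (simp add: left_deriv_eq_0)

lemma left_deriv_0 [simp]: "left_deriv \<xi> 0 = 0"
  by (simp add: left_deriv_eq_0)

text \<open>Supplies the generator that \<open>monomial_insert\<close> splits off in an induction
  over monomials.\<close>

lemma gen_less_minimal:
  assumes "finite S" "S \<noteq> {}"
  shows "\<exists>x\<in>S. \<forall>y\<in>S - {x}. x \<lhd> y"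
  using assms
proof (induction S rule: finite_ne_induct)
  case (insert a S)
  then obtain x where x: "x \<in> S" "\<forall>y\<in>S - {x}. x \<lhd> y" by blast
  show ?case
  proof (cases "x \<lhd> a")
    case True
    then show ?thesis using x by blast
  next
    case False
    then have ax: "a \<lhd> x" using gen_less_linear[of a x] insert.hyps x by metis
    have "a \<lhd> y" if "y \<in> S" for y
      using ax x(2) that gen_less_trans[of a x y] by (cases "y = x") simp_all
    then show ?thesis by simp
  qed
qed simp

text \<open>Passing a pair of generators across a third one costs two signs, which cancel. Induction
  over monomials and linearity extend this to all \<open>f\<close>.\<close>

lemma gen_mult_commute:
  fixes f :: "'g grassmann"
  shows "gen \<xi> * gen \<eta> * f = f * (gen \<xi> * gen \<eta>)"
proof -
  let ?m = "gen \<xi> * gen \<eta>"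
  have step: "?m * (gen x * g) = gen x * (?m * g)" for x g
    by (metis (no_types, opaque_lifting) gen_anticommute minus_minus mult.assoc mult_minus_left mult_minus_right)
  have mono: "?m * monomial S = monomial S * ?m" if "finite S" for S
    using that
  proof (induction "card S" arbitrary: S)
    case 0
    then show ?case by (simp add: monomial_empty)
  next
    case (Suc n)
    obtain x where x: "x \<in> S" "\<And>y. y \<in> S - {x} \<Longrightarrow> x \<lhd> y"
      using gen_less_minimal[of S] Suc by fastforce
    have S: "monomial S = gen x * monomial (S - {x})"
      using monomial_insert[of "S - {x}" x] x Suc.prems by (simp add: insert_absorb)
    have "?m * monomial S = gen x * (?m * monomial (S - {x}))"
      unfolding S by (rule step)
    also have "?m * monomial (S - {x}) = monomial (S - {x}) * ?m"
      using Suc x by (intro Suc.hyps) auto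
    finally show ?case
      unfolding S by (simp only: mult.assoc)
  qed
  have "?m * (\<Sum>S | gcoeff f S \<noteq> 0. gcoeff f S *\<^sub>R monomial S) =
      (\<Sum>S | gcoeff f S \<noteq> 0. gcoeff f S *\<^sub>R monomial S) * ?m"
    unfolding sum_distrib_left sum_distrib_right
    by (intro sum.cong refl) (metis (mono_tags) gcoeff_infinite mem_Collect_eq mono mult_scaleR_left mult_scaleR_right)
  then show ?thesis
    by (simp flip: monomial_expansion)
qed

lemma linear_berezin:
  assumes "finite \<Lambda>"
  shows "linear (berezin \<Lambda>)"
  using assms
proof (induction \<Lambda> rule: finite_induct)
  case (insert v \<Lambda>)
  have "berezin (insert v \<Lambda>) = left_deriv (PsiBar v) \<circ> (left_deriv (Psi v) \<circ> berezin \<Lambda>)"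
    using insert by (simp add: berezin_insert fun_eq_iff)
  then show ?case
    using insert.IH by (simp only:) (intro linear_compose linear_left_deriv)
qed (auto intro: linearI)

text \<open>Each vertex contributes two derivatives, so the signs of anticommutation cancel.\<close>

lemma left_deriv_berezin:
  assumes "finite \<Lambda>"
  shows "left_deriv \<xi> (berezin \<Lambda> f) = berezin \<Lambda> (left_deriv \<xi> f)"
  using assms
proof (induction \<Lambda> rule: finite_induct)
  case (insert v \<Lambda>)
  have "left_deriv \<xi> (berezin (insert v \<Lambda>) f) =
      left_deriv (PsiBar v) (left_deriv (Psi v) (left_deriv \<xi> (berezin \<Lambda> f)))"
    using insert.hyps by (simp add: berezin_insert left_deriv_anticommute[of \<xi>] left_deriv_minus)
  then show ?case
    using insert by (simp add: berezin_insert)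
qed simp

text \<open>In \<open>berezin_insert\<close> the derivatives at \<open>v\<close> act last; here they
  act first, as needed to integrate out a single vertex.\<close>

lemma berezin_insert_inner:
  assumes "finite \<Lambda>" "v \<notin> \<Lambda>"
  shows "berezin (insert v \<Lambda>) f = berezin \<Lambda> (left_deriv (PsiBar v) (left_deriv (Psi v) f))"
  using assms by (simp add: berezin_insert left_deriv_berezin)

lemma berezin_missing:
  assumes "finite \<Lambda>" "v \<in> \<Lambda>" "\<not> involves f (Psi v)"
  shows "berezin \<Lambda> f = 0"
proof -
  have "berezin (insert v (\<Lambda> - {v})) f = 0"
    using assms linear_0[OF linear_berezin[of "\<Lambda> - {v}"]]
    by (subst berezin_insert_inner) (simp_all add: left_deriv_eq_0)
  then show ?thesis
    using assms(2) by (simp add: insert_absorb)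
qed

text \<open>
  The sum of all \<open>left_deriv (Psi v)\<close> maps the top monomial to a combination of distinct monomials, so
  whatever it annihilates has no top coefficient.
\<close>

lemma berezin_translation_invariant:
  assumes "finite \<Lambda>" "\<Lambda> \<noteq> {}" "(\<Sum>v\<in>\<Lambda>. left_deriv (Psi v) f) = 0"
  shows "berezin \<Lambda> f = 0"
proof -
  obtain w where w: "w \<in> \<Lambda>" using assms(2) by blast
  let ?L = "\<Lambda> - {w}"
  \<comment> \<open>The derivative at \<open>w\<close> is traded for derivatives at the other
    vertices \<open>v\<close>. Those vanish under the integral over \<open>?L\<close>, whose result
    no longer involves \<open>Psi v\<close>.\<close>
  have "left_deriv (Psi w) f = - (\<Sum>v\<in>?L. left_deriv (Psi v) f)"
    using assms w by (simp add: sum.remove eq_neg_iff_add_eq_0)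
  then have "berezin ?L (left_deriv (Psi w) f) = - (\<Sum>v\<in>?L. berezin ?L (left_deriv (Psi v) f))"
    using assms(1) linear_berezin[of ?L] by (simp add: linear_neg linear_sum)
  also have "(\<Sum>v\<in>?L. berezin ?L (left_deriv (Psi v) f)) = 0"
  proof (intro sum.neutral ballI)
    fix v assume "v \<in> ?L"
    then have "\<not> involves (berezin ?L f) (Psi v)"
      using assms(1) involves_berezin[of ?L f "Psi v"] by blast
    then show "berezin ?L (left_deriv (Psi v) f) = 0"
      using assms(1) by (simp add: left_deriv_eq_0 flip: left_deriv_berezin)
  qed
  finally have "berezin (insert w ?L) f = 0"
    using assms(1)
    by (simp add: berezin_insert left_deriv_berezin[of _ "Psi w"] del: insert_Diff_single)
  then show ?thesis
    using w by (simp add: insert_absorb)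
qed

section \<open>Products of edge variables\<close>

lemma psi_anticommute: "psi \<Lambda> a * psi \<Lambda> b = - (psi \<Lambda> b * psi \<Lambda> a)"
  by (simp add: psi_def gen_anticommute[of "Psi a" "Psi b"])

lemma psi_square: "psi \<Lambda> a * psi \<Lambda> a = 0"
  by (simp add: psi_def gen_square)

lemma psi_psibar_commute: "psi \<Lambda> a * psibar \<Lambda> b * f = f * (psi \<Lambda> a * psibar \<Lambda> b)"
  by (simp add: psi_def psibar_def gen_mult_commute)

lemma zeta_expand:
  "zeta \<Lambda> tail tip e =
    psi \<Lambda> (tip e) * psibar \<Lambda> (tip e) - psi \<Lambda> (tip e) * psibar \<Lambda> (tail e) -
    (psi \<Lambda> (tail e) * psibar \<Lambda> (tip e) - psi \<Lambda> (tail e) * psibar \<Lambda> (tail e))"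
  by (simp add: zeta_def left_diff_distrib right_diff_distrib)

lemma zeta_commute: "zeta \<Lambda> tail tip e * f = f * zeta \<Lambda> tail tip e"
  unfolding zeta_expand left_diff_distrib right_diff_distrib psi_psibar_commute ..

text \<open>By centrality the two equal differences of \<open>psi\<close> in the square can be made
  adjacent, and an odd linear form squares to 0.\<close>

lemma zeta_square: "zeta \<Lambda> tail tip e * zeta \<Lambda> tail tip e = 0"
proof -
  let ?x = "psi \<Lambda> (tip e) - psi \<Lambda> (tail e)" and ?y = "psibar \<Lambda> (tip e) - psibar \<Lambda> (tail e)"
  have "?x * ?x = 0"
    by (simp add: left_diff_distrib right_diff_distrib psi_square
        psi_anticommute[of \<Lambda> "tail e" "tip e"])
  have "zeta \<Lambda> tail tip e * zeta \<Lambda> tail tip e = ?x * (zeta \<Lambda> tail tip e * ?y)"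
    unfolding zeta_commute[of \<Lambda> tail tip e ?y] by (simp add: zeta_def mult.assoc)
  also have "\<dots> = ?x * ?x * ?y * ?y"
    by (simp add: zeta_def mult.assoc)
  finally show ?thesis
    using \<open>?x * ?x = 0\<close> by simp
qed

definition zeta_center :: "'a set \<Rightarrow> ('a set \<Rightarrow> 'a) \<Rightarrow> ('a set \<Rightarrow> 'a) \<Rightarrow> 'a set \<Rightarrow>
    'a fermion grassmann center" where
  "zeta_center \<Lambda> tail tip e = to_center (zeta \<Lambda> tail tip e)"

lemma of_center_zeta [simp]: "of_center (zeta_center \<Lambda> tail tip e) = zeta \<Lambda> tail tip e"
  unfolding zeta_center_def by (intro of_center_to_center zeta_commute)

lemma zeta_center_square [simp]: "zeta_center \<Lambda> tail tip e * zeta_center \<Lambda> tail tip e = 0"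
  by (simp add: zeta_square flip: of_center_inject)

lemma cprod_zeta: "cprod (zeta \<Lambda> tail tip) T = of_center (\<Prod>e\<in>T. zeta_center \<Lambda> tail tip e)"
  using cprod_of_center[of "zeta_center \<Lambda> tail tip" T] by simp

lemma cprod_zeta_insert:
  assumes "finite T" "e \<notin> T"
  shows "cprod (zeta \<Lambda> tail tip) (insert e T) = zeta \<Lambda> tail tip e * cprod (zeta \<Lambda> tail tip) T"
  using assms by (simp add: cprod_zeta)

lemma cprod_zeta_empty [simp]: "cprod (zeta \<Lambda> tail tip) {} = 1"
  by (simp add: cprod_zeta)

lemma left_deriv_psi_mult:
  assumes "v \<in> \<Lambda>"
  shows "left_deriv (Psi v) (psi \<Lambda> a * g) =
    (if a = v then g else 0) - psi \<Lambda> a * left_deriv (Psi v) g"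
  using assms by (auto simp: psi_def left_deriv_gen_mult)

lemma left_deriv_psibar_mult:
  "left_deriv (Psi v) (psibar \<Lambda> a * g) = - (psibar \<Lambda> a * left_deriv (Psi v) g)"
  by (simp add: psibar_def left_deriv_gen_mult)

text \<open>As \<open>zeta\<close> has even degree, the second summand of the Leibniz rule carries
  no sign.\<close>

lemma left_deriv_zeta_mult:
  assumes "v \<in> \<Lambda>"
  shows "left_deriv (Psi v) (zeta \<Lambda> tail tip e * g) =
    (of_bool (tip e = v) - of_bool (tail e = v)) *
      ((psibar \<Lambda> (tip e) - psibar \<Lambda> (tail e)) * g) +
    zeta \<Lambda> tail tip e * left_deriv (Psi v) g"
  using assms
  by (simp add: zeta_def mult.assoc left_diff_distrib right_diff_distrib
      linear_diff[OF linear_left_deriv] left_deriv_psi_mult left_deriv_psibar_mult)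

text \<open>The sum of the derivatives generates the simultaneous translation of all
  \<open>psi\<close>. By the hypothesis an edge has both ends in \<Lambda>, and their contributions
  1 and -1 cancel, or it has none there.\<close>

lemma translation_cprod_zeta:
  assumes "finite \<Lambda>" "finite T" "\<And>e. e \<in> T \<Longrightarrow> tail e \<in> \<Lambda> \<longleftrightarrow> tip e \<in> \<Lambda>"
  shows "(\<Sum>v\<in>\<Lambda>. left_deriv (Psi v) (cprod (zeta \<Lambda> tail tip) T)) = 0"
  using assms(2,3)
proof (induction T rule: finite_induct)
  case (insert e T)
  let ?g = "cprod (zeta \<Lambda> tail tip) T"
  have "(\<Sum>v\<in>\<Lambda>. (of_bool (tip e = v) - of_bool (tail e = v)) :: 'a fermion grassmann) = 0"
    using assms(1) insert.prems[of e] by (simp add: sum_subtractf of_bool_def)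
  then have "(\<Sum>v\<in>\<Lambda>. (of_bool (tip e = v) - of_bool (tail e = v)) *
      ((psibar \<Lambda> (tip e) - psibar \<Lambda> (tail e)) * ?g)) = 0"
    by (simp only: sum_distrib_right [symmetric]) simp
  moreover have "(\<Sum>v\<in>\<Lambda>. left_deriv (Psi v) ?g) = 0"
    using insert by simp
  then have "(\<Sum>v\<in>\<Lambda>. zeta \<Lambda> tail tip e * left_deriv (Psi v) ?g) = 0"
    by (simp only: sum_distrib_left [symmetric]) simp
  ultimately show ?case
    using insert.hyps by (simp add: cprod_zeta_insert left_deriv_zeta_mult sum.distrib)
qed simp

lemma involves_cprod_zeta:
  assumes "finite T" "v \<notin> \<Lambda>"
  shows "\<not> involves (cprod (zeta \<Lambda> tail tip) T) (Psi v)"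
    "\<not> involves (cprod (zeta \<Lambda> tail tip) T) (PsiBar v)"
proof -
  have *: "\<not> involves (psi \<Lambda> a) \<xi>" "\<not> involves (psibar \<Lambda> a) \<xi>"
    if "\<xi> \<in> {Psi v, PsiBar v}" for a \<xi>
    using that assms(2) by (auto simp: psi_def psibar_def)
  have **: "\<not> involves (zeta \<Lambda> tail tip e) \<xi>" if "\<xi> \<in> {Psi v, PsiBar v}" for e \<xi>
    unfolding zeta_def using *[OF that] by (meson involves_diff involves_times)
  have "\<not> involves (cprod (zeta \<Lambda> tail tip) T) \<xi>" if "\<xi> \<in> {Psi v, PsiBar v}" for \<xi>
    using assms(1)
  proof (induction T rule: finite_induct)
    case (insert e T)
    then show ?case
      using **[OF that] involves_times by (metis cprod_zeta_insert)
  qed simp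
  then show "\<not> involves (cprod (zeta \<Lambda> tail tip) T) (Psi v)"
    "\<not> involves (cprod (zeta \<Lambda> tail tip) T) (PsiBar v)"
    by simp_all
qed

text \<open>In the presence of both generators at \<open>v\<close> these can be set to \<open>0\<close> elsewhere, which wires \<open>v\<close>.\<close>

lemma gen_pair_mult_zeta:
  assumes "v \<in> \<Lambda>"
  shows "gen (Psi v) * gen (PsiBar v) * zeta \<Lambda> tail tip e =
    gen (Psi v) * gen (PsiBar v) * zeta (\<Lambda> - {v}) tail tip e"
proof -
  let ?m = "gen (Psi v) * gen (PsiBar v)"
  have "?m * gen (Psi v) = gen (Psi v) * gen (Psi v) * gen (PsiBar v)"
    unfolding gen_mult_commute[of "Psi v" "PsiBar v" "gen (Psi v)"] by (simp only: mult.assoc)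
  then have m0: "?m * gen (Psi v) = 0" "?m * gen (PsiBar v) = 0"
    by (simp_all add: gen_square mult.assoc)
  have psi: "?m * psi \<Lambda> a = ?m * psi (\<Lambda> - {v}) a"
    "?m * psibar \<Lambda> a = ?m * psibar (\<Lambda> - {v}) a" for a
    using m0 by (auto simp: psi_def psibar_def)
  have "?m * (psi \<Lambda> a * psibar \<Lambda> b) = ?m * (psi (\<Lambda> - {v}) a * psibar (\<Lambda> - {v}) b)" for a b
  proof -
    have "?m * (psi \<Lambda> a * psibar \<Lambda> b) = psi (\<Lambda> - {v}) a * (?m * psibar \<Lambda> b)"
      by (metis psi(1) gen_mult_commute mult.assoc)
    also have "\<dots> = ?m * (psi (\<Lambda> - {v}) a * psibar (\<Lambda> - {v}) b)"
      by (metis psi(2) gen_mult_commute mult.assoc)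
    finally show ?thesis .
  qed
  then show ?thesis
    by (simp only: zeta_expand right_diff_distrib)
qed

lemma gen_pair_mult_cprod_zeta:
  assumes "v \<in> \<Lambda>" "finite T"
  shows "gen (Psi v) * gen (PsiBar v) * cprod (zeta \<Lambda> tail tip) T =
    gen (Psi v) * gen (PsiBar v) * cprod (zeta (\<Lambda> - {v}) tail tip) T"
  using assms(2)
proof (induction T rule: finite_induct)
  case (insert e T)
  let ?m = "gen (Psi v) * gen (PsiBar v)"
  have "?m * (zeta \<Lambda> tail tip e * cprod (zeta \<Lambda> tail tip) T) =
      zeta (\<Lambda> - {v}) tail tip e * (?m * cprod (zeta \<Lambda> tail tip) T)"
    by (metis gen_pair_mult_zeta[OF assms(1)] mult.assoc zeta_commute)
  also have "\<dots> = ?m * (zeta (\<Lambda> - {v}) tail tip e * cprod (zeta (\<Lambda> - {v}) tail tip) T)"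
    unfolding insert.IH by (metis mult.assoc zeta_commute)
  finally show ?case
    using insert.hyps by (simp add: cprod_zeta_insert)
qed simp

section \<open>Cuts, contraction and the integral of a product of edge variables\<close>

text \<open>
  Connectedness of the wired graph with edge set \<open>T\<close>, in terms of cuts: in this form it is evidently
  compatible with contracting an edge.
\<close>

definition cut_connected :: "'a set \<Rightarrow> 'a set set \<Rightarrow> bool" where
  "cut_connected \<Lambda> T \<longleftrightarrow> (\<forall>A\<subseteq>\<Lambda>. A \<noteq> {} \<longrightarrow> (\<exists>e\<in>T. e \<inter> A \<noteq> {} \<and> \<not> e \<subseteq> A))"

text \<open>Taking \<open>v\<close> out of \<Lambda> merges it with the outer vertex, which
  contracts \<open>e\<close>. Subsets of \<Lambda> containing \<open>v\<close> are crossed by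
  \<open>e\<close> itself, and the others are not touched by \<open>e\<close>.\<close>

lemma cut_connected_contract:
  assumes "e = {v, w}" "v \<in> \<Lambda>" "w \<notin> \<Lambda>" "e \<in> T"
  shows "cut_connected \<Lambda> T \<longleftrightarrow> cut_connected (\<Lambda> - {v}) (T - {e})"
proof
  assume L: "cut_connected \<Lambda> T"
  show "cut_connected (\<Lambda> - {v}) (T - {e})"
    unfolding cut_connected_def
  proof (intro allI impI)
    fix A assume "A \<subseteq> \<Lambda> - {v}" "A \<noteq> {}"
    then obtain f where "f \<in> T" "f \<inter> A \<noteq> {}" "\<not> f \<subseteq> A"
      using L unfolding cut_connected_def by (metis Diff_subset subset_trans)
    moreover have "e \<inter> A = {}"
      using assms \<open>A \<subseteq> \<Lambda> - {v}\<close> by auto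
    ultimately show "\<exists>e\<in>T - {e}. e \<inter> A \<noteq> {} \<and> \<not> e \<subseteq> A"
      by blast
  qed
next
  assume R: "cut_connected (\<Lambda> - {v}) (T - {e})"
  show "cut_connected \<Lambda> T"
    unfolding cut_connected_def
  proof (intro allI impI)
    fix A assume A: "A \<subseteq> \<Lambda>" "A \<noteq> {}"
    show "\<exists>e\<in>T. e \<inter> A \<noteq> {} \<and> \<not> e \<subseteq> A"
    proof (cases "v \<in> A")
      case True
      then show ?thesis using assms A by (intro bexI[of _ e]) auto
    next
      case False
      then have "A \<subseteq> \<Lambda> - {v}" using A by blast
      then obtain f where "f \<in> T - {e}" "f \<inter> A \<noteq> {}" "\<not> f \<subseteq> A"
        using R A(2) unfolding cut_connected_def by meson
      then show ?thesis by blast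
    qed
  qed
qed

text \<open>Contracting an edge that leaves \<Lambda> lowers both cardinalities by 1 and preserves
  cut-connectedness. Without such an edge \<Lambda> itself is an uncrossed cut, and translation
  invariance makes the integral vanish.\<close>

lemma gcoeff_berezin_cprod_zeta:
  assumes "finite \<Lambda>" "finite T" "orientation T tail tip"
  shows "gcoeff (berezin \<Lambda> (cprod (zeta \<Lambda> tail tip) T)) {} =
    of_bool (cut_connected \<Lambda> T \<and> card T = card \<Lambda>)"
  using assms
proof (induction "card \<Lambda>" arbitrary: \<Lambda> T)
  case 0
  then have L: "\<Lambda> = {}" by simp
  have "cut_connected {} T" by (auto simp: cut_connected_def)
  show ?case
  proof (cases "T = {}")
    case True
    then show ?thesis
      using L \<open>cut_connected {} T\<close> by (simp add: one_grassmann.rep_eq)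
  next
    case False
    then obtain e where e: "e \<in> T" by blast
    \<comment> \<open>With no vertices left every \<open>zeta\<close> is 0, so only the empty edge
      set has a nonzero integral.\<close>
    have "cprod (zeta {} tail tip) (insert e (T - {e})) = 0"
      using 0 by (subst cprod_zeta_insert) (simp_all add: zeta_def psi_def)
    then show ?thesis
      using L False e 0 by (simp add: insert_absorb zero_grassmann.rep_eq)
  qed
next
  case (Suc n)
  show ?case
  proof (cases "\<exists>e\<in>T. e \<inter> \<Lambda> \<noteq> {} \<and> \<not> e \<subseteq> \<Lambda>")
    case True
    then obtain e v w where e: "e \<in> T" "v \<in> e" "v \<in> \<Lambda>" "w \<in> e" "w \<notin> \<Lambda>" by blast
    have tt: "e = {tail e, tip e}"
      using Suc.prems(3) e(1) unfolding orientation_def by blast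
    then have or: "tail e = v \<and> tip e = w \<or> tail e = w \<and> tip e = v"
      using e by (metis empty_iff insert_iff)
    then have ez: "e = {v, w}" using tt by auto
    \<comment> \<open>The end \<open>w\<close> outside \<Lambda> contributes 0, and reversing the
      orientation flips the sign of both factors.\<close>
    have z: "zeta \<Lambda> tail tip e = gen (Psi v) * gen (PsiBar v)"
      using or e by (auto simp: zeta_def psi_def psibar_def)
    let ?L = "\<Lambda> - {v}" and ?T = "T - {e}"
    let ?g = "cprod (zeta ?L tail tip) ?T"
    have "cprod (zeta \<Lambda> tail tip) (insert e ?T) = gen (Psi v) * gen (PsiBar v) * ?g"
      using Suc.prems e z by (subst cprod_zeta_insert) (simp_all add: gen_pair_mult_cprod_zeta)
    then have c: "cprod (zeta \<Lambda> tail tip) T = gen (Psi v) * (gen (PsiBar v) * ?g)"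
      using e(1) by (simp add: insert_absorb mult.assoc)
    have "left_deriv (PsiBar v) (left_deriv (Psi v) (cprod (zeta \<Lambda> tail tip) T)) = ?g"
      unfolding c using Suc.prems involves_cprod_zeta[of ?T v ?L tail tip]
      by (simp add: left_deriv_gen_mult left_deriv_eq_0)
    then have "berezin (insert v ?L) (cprod (zeta \<Lambda> tail tip) T) = berezin ?L ?g"
      using Suc.prems by (subst berezin_insert_inner) simp_all
    then have "gcoeff (berezin \<Lambda> (cprod (zeta \<Lambda> tail tip) T)) {} = gcoeff (berezin ?L ?g) {}"
      using e(3) by (simp add: insert_absorb)
    also have "\<dots> = of_bool (cut_connected ?L ?T \<and> card ?T = card ?L)"
      using Suc e by (intro Suc.hyps(1)) (auto simp: orientation_def)
    also have "card ?T = card ?L \<longleftrightarrow> card T = card \<Lambda>"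
      using Suc.prems e by (metis One_nat_def card.remove nat.inject)
    also have "cut_connected ?L ?T \<longleftrightarrow> cut_connected \<Lambda> T"
      using cut_connected_contract[OF ez e(3,5,1)] ..
    finally show ?thesis .
  next
    case False
    have ne: "\<Lambda> \<noteq> {}" using Suc by auto
    have "tail e \<in> \<Lambda> \<longleftrightarrow> tip e \<in> \<Lambda>" if "e \<in> T" for e
    proof -
      have "e = {tail e, tip e}"
        using Suc.prems(3) that unfolding orientation_def by blast
      then show ?thesis using False that by blast
    qed
    then have "berezin \<Lambda> (cprod (zeta \<Lambda> tail tip) T) = 0"
      using Suc.prems ne by (intro berezin_translation_invariant translation_cprod_zeta) auto
    moreover have "\<not> cut_connected \<Lambda> T"
      using False ne unfolding cut_connected_def by blast
    ultimately show ?thesis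
      by (simp add: zero_grassmann.rep_eq)
  qed
qed

section \<open>Spanning trees of the wired graph\<close>

lemma rtranclp_exit:
  assumes "R\<^sup>*\<^sup>* x y" "x \<in> B" "y \<notin> B"
  obtains u v where "u \<in> B" "v \<notin> B" "R u v"
proof -
  from assms(1,2) have "y \<in> B \<or> (\<exists>u v. u \<in> B \<and> v \<notin> B \<and> R u v)"
    by (induction rule: rtranclp_induct) blast+
  then show ?thesis
    using assms(3) that by blast
qed

text \<open>Some edge crosses the cut \<Lambda> itself. Contracting it and recursing uses exactly
  one edge for each vertex of \<Lambda>.\<close>

lemma cut_connected_spanning_subset:
  assumes "finite \<Lambda>" "cut_connected \<Lambda> T" "\<And>e. e \<in> T \<Longrightarrow> \<exists>v w. e = {v, w}"
  shows "\<exists>T'\<subseteq>T. finite T' \<and> cut_connected \<Lambda> T' \<and> card T' = card \<Lambda>"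
  using assms
proof (induction "card \<Lambda>" arbitrary: \<Lambda> T)
  case 0
  then show ?case
    by (intro exI[of _ "{}"]) (auto simp: cut_connected_def)
next
  case (Suc n)
  then have "\<Lambda> \<noteq> {}" by auto
  then obtain e where e: "e \<in> T" "e \<inter> \<Lambda> \<noteq> {}" "\<not> e \<subseteq> \<Lambda>"
    using Suc.prems(2) unfolding cut_connected_def by blast
  then obtain v w where vw: "e = {v, w}" "v \<in> \<Lambda>" "w \<notin> \<Lambda>"
    using Suc.prems(3)[of e] by fastforce
  have "\<exists>T'\<subseteq>T - {e}. finite T' \<and> cut_connected (\<Lambda> - {v}) T' \<and> card T' = card (\<Lambda> - {v})"
    using Suc.hyps(2) Suc.prems cut_connected_contract[OF vw e(1)] vw(2)
    by (intro Suc.hyps(1)) auto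
  then obtain T' where T': "T' \<subseteq> T - {e}" "finite T'" "cut_connected (\<Lambda> - {v}) T'"
    "card T' = card (\<Lambda> - {v})" by blast
  have ne: "e \<notin> T'" using T'(1) by blast
  then have "cut_connected \<Lambda> (insert e T')"
    using cut_connected_contract[OF vw, of "insert e T'"] T'(3) by simp
  moreover have "card (insert e T') = card \<Lambda>"
    using ne T'(2,4) vw(2) Suc.prems(1) Suc.hyps(2) by simp
  ultimately show ?case
    using T'(1,2) e(1) by (intro exI[of _ "insert e T'"]) auto
qed

lemma wire_in_Some_image: "A \<subseteq> \<Lambda> \<Longrightarrow> wire \<Lambda> x \<in> Some ` A \<longleftrightarrow> x \<in> A"
  by (auto simp: wire_def)

text \<open>Wiring identifies no vertex of \<open>A\<close> with another vertex, so whether an edge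
  crosses the cut can be read off from its wired endpoints.\<close>

lemma crosses_wire_iff:
  assumes "A \<subseteq> \<Lambda>" "wire \<Lambda> ` e = {x, y}"
  shows "e \<inter> A \<noteq> {} \<and> \<not> e \<subseteq> A \<longleftrightarrow> (x \<in> Some ` A) \<noteq> (y \<in> Some ` A)"
proof -
  have "e \<inter> A \<noteq> {} \<longleftrightarrow> wire \<Lambda> ` e \<inter> Some ` A \<noteq> {}"
    using wire_in_Some_image[OF assms(1)] by blast
  moreover have "e \<subseteq> A \<longleftrightarrow> wire \<Lambda> ` e \<subseteq> Some ` A"
    using wire_in_Some_image[OF assms(1)] by blast
  ultimately show ?thesis
    unfolding assms(2) by auto
qed

text \<open>A cycle which enters a set by one of its edges must leave it by another one.\<close>

lemma cut_connected_remove_cycle_edge: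
  assumes cyc: "multigraph_cycle (\<lambda>e. wire \<Lambda> ` e) xs es" and es: "set es \<subseteq> T" "e \<in> set es"
    and conn: "cut_connected \<Lambda> T"
  shows "cut_connected \<Lambda> (T - {e})"
  unfolding cut_connected_def
proof (intro allI impI)
  fix A assume A: "A \<subseteq> \<Lambda>" "A \<noteq> {}"
  show "\<exists>f\<in>T - {e}. f \<inter> A \<noteq> {} \<and> \<not> f \<subseteq> A"
  proof (rule ccontr)
    assume no: "\<not> ?thesis"
    obtain f where "f \<in> T" "f \<inter> A \<noteq> {} \<and> \<not> f \<subseteq> A"
      using conn A unfolding cut_connected_def by meson
    then have cross: "e \<inter> A \<noteq> {} \<and> \<not> e \<subseteq> A"
      using no by blast
    let ?n = "length es" and ?B = "Some ` A"
    obtain i where i: "i < ?n" "e = es ! i"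
      using es(2) by (metis in_set_conv_nth)
    have ends: "wire \<Lambda> ` (es ! j) = {xs ! j, xs ! (Suc j mod ?n)}" if "j < ?n" for j
      using cyc that by (simp add: multigraph_cycle_def)
    have same: "xs ! j \<in> ?B \<longleftrightarrow> xs ! (Suc j mod ?n) \<in> ?B" if "j < ?n" "j \<noteq> i" for j
    proof -
      have "es ! j \<noteq> e"
        using cyc that i by (simp add: multigraph_cycle_def nth_eq_iff_index_eq)
      then have "\<not> (es ! j \<inter> A \<noteq> {} \<and> \<not> es ! j \<subseteq> A)"
        using no es(1) that(1) nth_mem by blast
      then show ?thesis
        using crosses_wire_iff[OF A(1) ends[OF that(1)]] by simp
    qed
    \<comment> \<open>Going around the cycle from the far end of \<open>e\<close>, fewer than
      \<open>?n\<close> steps never use the edge at \<open>i\<close>, so none of them crosses the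
      cut. After \<open>?n - 1\<close> steps the near end of \<open>e\<close> is reached, so
      \<open>e\<close> does not cross the cut either.\<close>
    have walk: "k < ?n \<Longrightarrow> xs ! (Suc (i + k) mod ?n) \<in> ?B \<longleftrightarrow> xs ! (Suc i mod ?n) \<in> ?B" for k
    proof (induction k)
      case (Suc k)
      let ?j = "Suc (i + k) mod ?n"
      have "?j \<noteq> i"
      proof (cases "Suc (i + k) < ?n")
        case False
        then have "?j = Suc (i + k) - ?n"
          using Suc.prems i(1) by (simp add: le_mod_geq)
        then show ?thesis using Suc.prems False by linarith
      qed simp
      moreover have "?j < ?n"
        using i(1) by (intro mod_less_divisor) auto
      ultimately have "xs ! ?j \<in> ?B \<longleftrightarrow> xs ! (Suc ?j mod ?n) \<in> ?B"
        by (rule same[rotated])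
      then show ?case
        using Suc by (simp add: mod_Suc_eq)
    qed simp
    have "Suc (i + (?n - 1)) = ?n + i"
      using i(1) by simp
    then have "Suc (i + (?n - 1)) mod ?n = i"
      using i(1) by simp
    then have "xs ! i \<in> ?B \<longleftrightarrow> xs ! (Suc i mod ?n) \<in> ?B"
      using walk[of "?n - 1"] i(1) by simp
    then show False
      using crosses_wire_iff[OF A(1) ends[OF i(1)]] cross i(2) by simp
  qed
qed

section \<open>Paths, cycles and the two forms of connectedness\<close>

lemma simple_path_exists:
  assumes "(\<lambda>x y. \<exists>e\<in>T. ends e = {x, y})\<^sup>*\<^sup>* x y"
  shows "\<exists>xs es. distinct xs \<and> xs \<noteq> [] \<and> hd xs = x \<and> last xs = y \<and>
    length xs = Suc (length es) \<and> set es \<subseteq> T \<and>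
    (\<forall>i < length es. ends (es ! i) = {xs ! i, xs ! Suc i})"
  using assms
proof (induction rule: converse_rtranclp_induct)
  case base
  show ?case by (intro exI[of _ "[y]"] exI[of _ "[]"]) simp
next
  case (step x z)
  then obtain xs es where p: "distinct xs" "xs \<noteq> []" "hd xs = z" "last xs = y"
    "length xs = Suc (length es)" "set es \<subseteq> T"
    "\<forall>i < length es. ends (es ! i) = {xs ! i, xs ! Suc i}" by blast
  from step obtain e where e: "e \<in> T" "ends e = {x, z}" by blast
  show ?case
  proof (cases "x \<in> set xs")
    case False
    have "\<forall>i < length (e # es). ends ((e # es) ! i) = {(x # xs) ! i, (x # xs) ! Suc i}"
      using p e by (auto simp: nth_Cons hd_conv_nth split: nat.split)
    then show ?thesis
      using p e False by (intro exI[of _ "x # xs"] exI[of _ "e # es"]) simp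
  next
    \<comment> \<open>Prepending \<open>x\<close> would repeat a vertex; instead the part of the
      path before the occurrence of \<open>x\<close> is dropped.\<close>
    case True
    then obtain m where m: "m < length xs" "xs ! m = x"
      by (metis in_set_conv_nth)
    have "set (drop m es) \<subseteq> T"
      using p(6) set_drop_subset[of m es] by blast
    then show ?thesis
      using p m by (intro exI[of _ "drop m xs"] exI[of _ "drop m es"])
        (simp add: hd_drop_conv_nth Suc_diff_le)
  qed
qed

text \<open>A simple path between the ends of \<open>e\<close> is closed to a cycle by
  \<open>e\<close>. If \<open>x = y\<close>, the path is trivial and \<open>e\<close> alone is a
  cycle of length 1.\<close>

lemma cycle_if_redundant_edge:
  assumes path: "(\<lambda>x y. \<exists>e\<in>T. ends e = {x, y})\<^sup>*\<^sup>* x y"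
    and e: "ends e = {x, y}" "e \<notin> T"
  shows "\<exists>xs es. set es \<subseteq> insert e T \<and> multigraph_cycle ends xs es"
proof -
  obtain xs es where p: "distinct xs" "xs \<noteq> []" "hd xs = x" "last xs = y"
    "length xs = Suc (length es)" "set es \<subseteq> T"
    "\<And>i. i < length es \<Longrightarrow> ends (es ! i) = {xs ! i, xs ! Suc i}"
    using simple_path_exists[OF path] by blast
  have "distinct es"
    unfolding distinct_conv_nth
  proof (intro allI impI notI)
    fix i j assume ij: "i < length es" "j < length es" "i \<noteq> j" "es ! i = es ! j"
    then have "{xs ! i, xs ! Suc i} = {xs ! j, xs ! Suc j}"
      using p(7)[of i] p(7)[of j] by simp
    \<comment> \<open>As the vertices are distinct, the second case would force both
      \<open>i = Suc j\<close> and \<open>Suc i = j\<close>.\<close>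
    then have "xs ! i = xs ! j \<or> xs ! i = xs ! Suc j \<and> xs ! Suc i = xs ! j"
      by (auto simp: doubleton_eq_iff)
    then show False
      using ij p(1,5) by (auto simp: nth_eq_iff_index_eq)
  qed
  have "multigraph_cycle ends xs (es @ [e])"
    unfolding multigraph_cycle_def
  proof (intro conjI allI impI)
    show "distinct (es @ [e])"
      using \<open>distinct es\<close> p(6) e(2) by auto
    fix i assume "i < length (es @ [e])"
    then consider "i < length es" | "i = length es" by fastforce
    then show "ends ((es @ [e]) ! i) = {xs ! i, xs ! (Suc i mod length (es @ [e]))}"
    proof cases
      case 1
      then show ?thesis using p(7) by (simp add: nth_append)
    next
      case 2
      have "xs ! length es = y" "xs ! 0 = x"
        using p by (simp_all add: hd_conv_nth last_conv_nth)
      then show ?thesis using e(1) 2 by (simp add: insert_commute)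
    qed
  qed (use p in simp_all)
  then show ?thesis
    using p(6) by (intro exI[of _ xs] exI[of _ "es @ [e]"]) auto
qed

text \<open>A path from \<open>A\<close> to the outer vertex has to leave \<open>A\<close>; a vertex
  of \<open>W\<close> outside \<Lambda> ensures that the outer vertex is present.\<close>

lemma cut_connected_if_connected:
  assumes "multigraph_connected (wire \<Lambda> ` W) T (\<lambda>e. wire \<Lambda> ` e)" "\<Lambda> \<subset> W"
  shows "cut_connected \<Lambda> T"
  unfolding cut_connected_def
proof (intro allI impI)
  fix A assume A: "A \<subseteq> \<Lambda>" "A \<noteq> {}"
  let ?R = "\<lambda>x y. \<exists>e\<in>T. wire \<Lambda> ` e = {x, y}"
  obtain a w where a: "a \<in> A" "w \<in> W" "w \<notin> \<Lambda>" using A assms(2) by blast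
  then have "wire \<Lambda> a \<in> wire \<Lambda> ` W" "wire \<Lambda> w \<in> wire \<Lambda> ` W"
    using A assms(2) by auto
  then have "?R\<^sup>*\<^sup>* (wire \<Lambda> a) (wire \<Lambda> w)"
    using assms(1) unfolding multigraph_connected_def by blast
  moreover have "wire \<Lambda> a \<in> Some ` A" "wire \<Lambda> w \<notin> Some ` A"
    using a A by (auto simp: wire_def)
  ultimately obtain x y where xy: "x \<in> Some ` A" "y \<notin> Some ` A" "?R x y"
    by (rule rtranclp_exit)
  then obtain e where "e \<in> T" "wire \<Lambda> ` e = {x, y}" by blast
  then show "\<exists>e\<in>T. e \<inter> A \<noteq> {} \<and> \<not> e \<subseteq> A"
    using xy(1,2) crosses_wire_iff[OF A(1), of e x y] by (intro bexI[of _ e]) auto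
qed

lemma connected_if_cut_connected:
  assumes "cut_connected \<Lambda> T" "\<Lambda> \<subset> W" "\<And>e. e \<in> T \<Longrightarrow> \<exists>v w. e = {v, w}"
  shows "multigraph_connected (wire \<Lambda> ` W) T (\<lambda>e. wire \<Lambda> ` e)"
proof -
  let ?R = "\<lambda>x y. \<exists>e\<in>T. wire \<Lambda> ` e = {x, y}"
  have sym: "symp ?R" by (rule sympI) (metis insert_commute)
  \<comment> \<open>The vertices not joined to the outer vertex. An edge crossing this set would
    join one of them to the outer vertex after all.\<close>
  let ?A = "{x \<in> \<Lambda>. \<not> ?R\<^sup>*\<^sup>* (Some x) None}"
  have "?A = {}"
  proof (rule ccontr)
    assume "?A \<noteq> {}"
    moreover have "?A \<subseteq> \<Lambda>" by blast
    ultimately obtain e where e: "e \<in> T" "e \<inter> ?A \<noteq> {}" "\<not> e \<subseteq> ?A"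
      using assms(1) unfolding cut_connected_def by meson
    obtain p q where "e = {p, q}" using assms(3)[OF e(1)] by blast
    then obtain p q where pq: "e = {p, q}" "p \<in> ?A" "q \<notin> ?A"
      using e(2,3) by (cases "p \<in> ?A") (auto simp: insert_commute)
    have "wire \<Lambda> ` e = {Some p, wire \<Lambda> q}"
      using pq by (simp add: wire_def)
    then have "?R (Some p) (wire \<Lambda> q)"
      using e(1) by blast
    moreover have "?R\<^sup>*\<^sup>* (wire \<Lambda> q) None"
      using pq(3) by (auto simp: wire_def)
    ultimately have "?R\<^sup>*\<^sup>* (Some p) None"
      by (rule converse_rtranclp_into_rtranclp)
    then show False using pq(2) by blast
  qed
  then have root: "?R\<^sup>*\<^sup>* (wire \<Lambda> x) None" for x
    by (auto simp: wire_def)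
  have "?R\<^sup>*\<^sup>* (wire \<Lambda> x) (wire \<Lambda> y)" for x y
    using root[of x] sympD[OF symp_rtranclp[OF sym] root[of y]] by (rule rtranclp_trans)
  then show ?thesis
    using assms(2) by (auto simp: multigraph_connected_def)
qed

text \<open>Counting edges replaces acyclicity. An edge beyond a cut-connected subset closes a
  cycle; conversely, deleting an edge of a cycle keeps cut-connectedness, which takes at least
  \<open>card \<Lambda>\<close> edges.\<close>

lemma spanning_tree_wired_iff:
  assumes "finite \<Lambda>" "\<Lambda> \<subset> W" "finite E" "\<And>e. e \<in> E \<Longrightarrow> \<exists>v w. e = {v, w}"
  shows "spanning_tree (wire \<Lambda> ` W) E (\<lambda>e. wire \<Lambda> ` e) T \<longleftrightarrow>
    T \<subseteq> E \<and> cut_connected \<Lambda> T \<and> card T = card \<Lambda>"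
proof (cases "T \<subseteq> E")
  case True
  then have fin: "finite T" and edges: "\<And>e. e \<in> T \<Longrightarrow> \<exists>v w. e = {v, w}"
    using assms(3,4) by (auto intro: finite_subset)
  let ?acyclic = "\<not> (\<exists>xs es. set es \<subseteq> T \<and> multigraph_cycle (\<lambda>e. wire \<Lambda> ` e) xs es)"
  have "?acyclic \<longleftrightarrow> card T = card \<Lambda>" if conn: "cut_connected \<Lambda> T"
  proof
    assume acyclic: ?acyclic
    obtain T' where T': "T' \<subseteq> T" "cut_connected \<Lambda> T'" "card T' = card \<Lambda>"
      using cut_connected_spanning_subset[OF assms(1) conn edges] by blast
    have "T' = T"
    proof (rule ccontr)
      assume "T' \<noteq> T"
      then obtain e where e: "e \<in> T" "e \<notin> T'" using T'(1) by blast
      then obtain v w where vw: "e = {v, w}" using edges by blast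
      \<comment> \<open>The ends \<open>v\<close> and \<open>w\<close> are not known to lie in
        \<open>W\<close>, so they are adjoined to the vertex set.\<close>
      have "multigraph_connected (wire \<Lambda> ` insert v (insert w W)) T' (\<lambda>e. wire \<Lambda> ` e)"
        using T' edges assms(2) by (intro connected_if_cut_connected) auto
      then have "(\<lambda>x y. \<exists>e\<in>T'. wire \<Lambda> ` e = {x, y})\<^sup>*\<^sup>* (wire \<Lambda> v) (wire \<Lambda> w)"
        unfolding multigraph_connected_def by blast
      moreover have "wire \<Lambda> ` e = {wire \<Lambda> v, wire \<Lambda> w}"
        using vw by simp
      ultimately obtain xs es where
        "set es \<subseteq> insert e T'" "multigraph_cycle (\<lambda>e. wire \<Lambda> ` e) xs es"
        using cycle_if_redundant_edge[of T' "\<lambda>e. wire \<Lambda> ` e"] e(2) by meson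
      then show False
        using acyclic e(1) T'(1) by blast
    qed
    then show "card T = card \<Lambda>" using T'(3) by simp
  next
    assume card: "card T = card \<Lambda>"
    show ?acyclic
    proof
      assume "\<exists>xs es. set es \<subseteq> T \<and> multigraph_cycle (\<lambda>e. wire \<Lambda> ` e) xs es"
      then obtain xs es where c: "set es \<subseteq> T" "multigraph_cycle (\<lambda>e. wire \<Lambda> ` e) xs es" by blast
      then have e: "hd es \<in> set es" by (simp add: multigraph_cycle_def)
      have "cut_connected \<Lambda> (T - {hd es})"
        using cut_connected_remove_cycle_edge[OF c(2,1) e conn] .
      then obtain T' where "T' \<subseteq> T - {hd es}" "card T' = card \<Lambda>"
        using cut_connected_spanning_subset[OF assms(1), of "T - {hd es}"] edges by blast
      then have "card \<Lambda> \<le> card (T - {hd es})"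
        using fin card_mono by (metis finite_Diff)
      moreover have "card (T - {hd es}) < card T"
        using fin e c(1) by (intro psubset_card_mono) auto
      ultimately show False using card by simp
    qed
  qed
  then show ?thesis
    unfolding spanning_tree_def
    using True cut_connected_if_connected[OF _ assms(2)]
      connected_if_cut_connected[OF _ assms(2) edges] by blast
qed (simp add: spanning_tree_def)

text \<open>A path in the original graph to a vertex outside \<Lambda> leaves \<open>A\<close>
  through an edge meeting \<Lambda>. This yields the existence of a spanning tree.\<close>

lemma cut_connected_edges_meeting:
  assumes "connected_graph W adj" "\<Lambda> \<subset> W"
  shows "cut_connected \<Lambda> (edges_meeting adj \<Lambda>)"
  unfolding cut_connected_def
proof (intro allI impI)
  fix A assume A: "A \<subseteq> \<Lambda>" "A \<noteq> {}"
  obtain a w where a: "a \<in> A" "w \<in> W" "w \<notin> \<Lambda>" using A assms(2) by blast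
  then have "adj\<^sup>*\<^sup>* a w"
    using assms A unfolding connected_graph_def by blast
  moreover have "w \<notin> A" using a A by blast
  ultimately obtain u v where "u \<in> A" "v \<notin> A" "adj u v"
    using a(1) by (elim rtranclp_exit)
  then show "\<exists>e\<in>edges_meeting adj \<Lambda>. e \<inter> A \<noteq> {} \<and> \<not> e \<subseteq> A"
    using A(1) by (intro bexI[of _ "{u, v}"]) (auto simp: edges_meeting_def)
qed

lemma finite_edges_meeting:
  assumes "locally_finite_graph W adj" "finite \<Lambda>" "\<Lambda> \<subseteq> W"
  shows "finite (edges_meeting adj \<Lambda>)"
proof -
  have "edges_meeting adj \<Lambda> \<subseteq> (\<Union>u\<in>\<Lambda>. (\<lambda>w. {u, w}) ` {w. adj u w})"
    by (auto simp: edges_meeting_def)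
  then show ?thesis
    using assms by (elim finite_subset) (auto simp: locally_finite_graph_def)
qed

lemma wired_spanning_trees_eq:
  assumes "locally_finite_graph W adj" "finite \<Lambda>" "\<Lambda> \<subset> W"
  shows "wired_spanning_trees W adj \<Lambda> =
    {T. T \<subseteq> edges_meeting adj \<Lambda> \<and> cut_connected \<Lambda> T \<and> card T = card \<Lambda>}"
proof -
  have "finite (edges_meeting adj \<Lambda>)"
    using assms by (intro finite_edges_meeting) auto
  then have "spanning_tree (wire \<Lambda> ` W) (edges_meeting adj \<Lambda>) (\<lambda>e. wire \<Lambda> ` e) T \<longleftrightarrow>
      T \<subseteq> edges_meeting adj \<Lambda> \<and> cut_connected \<Lambda> T \<and> card T = card \<Lambda>" for T
    using assms by (intro spanning_tree_wired_iff) (auto simp: edges_meeting_def)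
  then show ?thesis
    unfolding wired_spanning_trees_def by (intro Collect_cong)
qed

section \<open>Gaussian integrals\<close>

lemma involves_of_center_prod:
  assumes "\<And>i. i \<in> I \<Longrightarrow> \<not> involves (of_center (f i)) \<xi>"
  shows "\<not> involves (of_center (prod f I)) \<xi>"
  using assms
  by (induction I rule: infinite_finite_induct) (auto dest: involves_times)

lemma berezin_missing_bar:
  assumes "finite \<Lambda>" "v \<in> \<Lambda>" "\<not> involves f (PsiBar v)"
  shows "berezin \<Lambda> f = 0"
proof -
  have "berezin (insert v (\<Lambda> - {v})) f = 0"
    using assms linear_0[OF linear_berezin[of "\<Lambda> - {v}"]]
    by (subst berezin_insert_inner)
      (simp_all add: left_deriv_anticommute[of "PsiBar v" "Psi v"] left_deriv_eq_0)
  then show ?thesis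
    using assms(2) by (simp add: insert_absorb)
qed

definition berezin_integral :: "'a set \<Rightarrow> 'a fermion grassmann \<Rightarrow> real" where
  "berezin_integral \<Lambda> P = gcoeff (berezin \<Lambda> P) {}"

lemma berezin_integral_sum:
  assumes "finite \<Lambda>"
  shows "berezin_integral \<Lambda> (\<Sum>i\<in>I. f i) = (\<Sum>i\<in>I. berezin_integral \<Lambda> (f i))"
  by (simp add: berezin_integral_def linear_sum[OF linear_berezin[OF assms]] gcoeff_sum)

lemma berezin_integral_scaleR:
  assumes "finite \<Lambda>"
  shows "berezin_integral \<Lambda> (c *\<^sub>R P) = c * berezin_integral \<Lambda> P"
  by (simp add: berezin_integral_def linear_cmul[OF linear_berezin[OF assms]] scaleR_grassmann.rep_eq)

lemma berezin_integral_minus: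
  assumes "finite \<Lambda>"
  shows "berezin_integral \<Lambda> (- P) = - berezin_integral \<Lambda> P"
  using berezin_integral_scaleR[OF assms, of "- 1" P] by simp

definition fermion_pair :: "'a \<Rightarrow> 'a \<Rightarrow> 'a fermion grassmann center" where
  "fermion_pair u v = to_center (gen (Psi u) * gen (PsiBar v))"

lemma of_center_fermion_pair [simp]: "of_center (fermion_pair u v) = gen (Psi u) * gen (PsiBar v)"
  unfolding fermion_pair_def by (intro of_center_to_center gen_mult_commute)

text \<open>Exchanging the two \<open>PsiBar\<close> factors costs one sign, the source of the signs
  in the determinant.\<close>

lemma fermion_pair_swap: "fermion_pair a x * fermion_pair b y = - (fermion_pair a y * fermion_pair b x)"
proof -
  let ?a = "gen (Psi a)" and ?b = "gen (Psi b)" and ?x = "gen (PsiBar x)" and ?y = "gen (PsiBar y)"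
  have "?a * ?x * (?b * ?y) = - (?a * ?b * (?x * ?y))"
    by (metis gen_anticommute mult.assoc mult_minus_left mult_minus_right)
  also have "\<dots> = ?a * ?b * (?y * ?x)"
    by (metis gen_anticommute minus_minus mult_minus_right)
  also have "\<dots> = - (?a * ?y * (?b * ?x))"
    by (metis gen_anticommute mult.assoc mult_minus_left mult_minus_right)
  finally show ?thesis
    by (simp flip: of_center_inject)
qed

lemma berezin_integral_diagonal:
  assumes "finite \<Lambda>"
  shows "berezin_integral \<Lambda> (of_center (\<Prod>u\<in>\<Lambda>. fermion_pair u u)) = 1"
  using assms
proof (induction \<Lambda> rule: finite_induct)
  case (insert v \<Lambda>)
  let ?g = "of_center (\<Prod>u\<in>\<Lambda>. fermion_pair u u)"
  have "\<not> involves ?g (Psi v)" "\<not> involves ?g (PsiBar v)"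
    using insert.hyps by (auto intro!: involves_of_center_prod dest!: involves_times)
  then have "left_deriv (PsiBar v) (left_deriv (Psi v) (gen (Psi v) * (gen (PsiBar v) * ?g))) = ?g"
    by (simp add: left_deriv_gen_mult left_deriv_eq_0)
  then show ?case
    using insert by (simp add: berezin_integral_def berezin_insert_inner mult.assoc)
qed (simp add: berezin_integral_def one_grassmann.rep_eq)

text \<open>Induction over transpositions: each one flips the sign of the product, by
  \<open>fermion_pair_swap\<close>, and the sign of the permutation.\<close>

lemma berezin_integral_permutation:
  assumes "finite \<Lambda>" "p permutes \<Lambda>"
  shows "berezin_integral \<Lambda> (of_center (\<Prod>u\<in>\<Lambda>. fermion_pair u (p u))) = of_int (sign p)"
  using assms
proof (induction rule: permutes_rev_induct)
  case id
  then show ?case using assms(1) by (simp add: berezin_integral_diagonal)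
next
  case (swap a b p)
  let ?q = "p \<circ> Transposition.transpose a b"
  have split: "(\<Prod>u\<in>\<Lambda>. fermion_pair u (r u)) =
      fermion_pair a (r a) * fermion_pair b (r b) * (\<Prod>u\<in>\<Lambda> - {a} - {b}. fermion_pair u (r u))" for r
    using assms(1) swap.hyps by (simp add: prod.remove[of _ a] prod.remove[of _ b] mult.assoc)
  have "(\<Prod>u\<in>\<Lambda> - {a} - {b}. fermion_pair u (?q u)) = (\<Prod>u\<in>\<Lambda> - {a} - {b}. fermion_pair u (p u))"
    by (intro prod.cong) (auto simp: transpose_apply_other)
  then have "(\<Prod>u\<in>\<Lambda>. fermion_pair u (?q u)) = - (\<Prod>u\<in>\<Lambda>. fermion_pair u (p u))"
    unfolding split[of ?q] split[of p] by (simp add: fermion_pair_swap[of a "p b" b "p a"])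
  moreover have "sign ?q = - sign p"
    using swap.hyps assms(1)
    by (simp add: sign_compose sign_swap_id permutes_imp_permutation permutation_swap_id)
  ultimately show ?case
    using swap.IH assms(1) by (simp add: berezin_integral_minus del: comp_apply)
qed

text \<open>Scalars act on the algebra, so a scaled central element is taken back into the center by
  \<open>to_center\<close>.\<close>

lemma of_center_to_center_scaleR:
  "of_center (to_center (c *\<^sub>R of_center z :: 'g grassmann)) = c *\<^sub>R of_center z"
  by (intro of_center_to_center) (simp add: of_center_commute)

lemma of_center_prod_scaleR:
  "of_center (\<Prod>i\<in>I. to_center (c i *\<^sub>R of_center (z i))) =
    (\<Prod>i\<in>I. c i) *\<^sub>R (of_center (\<Prod>i\<in>I. z i) :: 'g grassmann)"
  by (induction I rule: infinite_finite_induct) (simp_all add: of_center_to_center_scaleR)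

text \<open>A self-map of a finite set which is not bijective misses some \<open>v\<close>, and then
  \<open>PsiBar v\<close> does not occur in the product.\<close>

lemma berezin_integral_function:
  assumes "finite \<Lambda>" "g \<in> \<Lambda> \<rightarrow>\<^sub>E \<Lambda>" "\<not> bij_betw g \<Lambda> \<Lambda>"
  shows "berezin_integral \<Lambda> (of_center (\<Prod>u\<in>\<Lambda>. fermion_pair u (g u))) = 0"
proof -
  have "g ` \<Lambda> \<subseteq> \<Lambda>" using assms(2) by auto
  moreover have "g ` \<Lambda> \<noteq> \<Lambda>"
    using assms(1,3) by (metis bij_betw_def finite_surj_inj subset_refl)
  ultimately obtain v where v: "v \<in> \<Lambda>" "v \<notin> g ` \<Lambda>" by blast
  then have "\<not> involves (of_center (\<Prod>u\<in>\<Lambda>. fermion_pair u (g u))) (PsiBar v)"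
    by (intro involves_of_center_prod) (auto dest!: involves_times)
  then show ?thesis
    using assms(1) v(1) by (simp add: berezin_integral_def berezin_missing_bar zero_grassmann.rep_eq)
qed

text \<open>The row sums \<open>?y u\<close> square to 0, so the exponential expands over sets of
  rows. Only the full set supplies every \<open>Psi v\<close>; expanding its product over functions
  leaves the bijections, which is the Leibniz formula.\<close>

lemma berezin_integral_gexp:
  assumes "finite \<Lambda>"
  shows "berezin_integral \<Lambda> (gexp (\<Sum>u\<in>\<Lambda>. \<Sum>v\<in>\<Lambda>. A u v *\<^sub>R (psi \<Lambda> u * psibar \<Lambda> v))) = det_on \<Lambda> A"
proof -
  let ?c = "\<lambda>u v. to_center (A u v *\<^sub>R of_center (fermion_pair u v))"
  let ?y = "\<lambda>u. \<Sum>v\<in>\<Lambda>. ?c u v"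
  let ?t = "\<lambda>g. (\<Prod>u\<in>\<Lambda>. A u (g u)) * berezin_integral \<Lambda> (of_center (\<Prod>u\<in>\<Lambda>. fermion_pair u (g u)))"
  have y: "of_center (?y u) = gen (Psi u) * (\<Sum>v\<in>\<Lambda>. A u v *\<^sub>R gen (PsiBar v))" for u
    by (simp only: of_center_sum of_center_to_center_scaleR) (simp add: sum_distrib_left)
  have y2: "?y u * ?y u = 0" for u
  proof -
    have "of_center (?y u * ?y u) =
        gen (Psi u) * (of_center (?y u) * (\<Sum>v\<in>\<Lambda>. A u v *\<^sub>R gen (PsiBar v)))"
      by (subst of_center_commute) (simp only: times_center.rep_eq y mult.assoc)
    also have "\<dots> = 0"
      unfolding y by (simp add: gen_square flip: mult.assoc)
    finally show ?thesis
      by (simp only: of_center_inject [symmetric] zero_center.rep_eq)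
  qed
  have "(\<Sum>u\<in>\<Lambda>. \<Sum>v\<in>\<Lambda>. A u v *\<^sub>R (psi \<Lambda> u * psibar \<Lambda> v)) = of_center (\<Sum>u\<in>\<Lambda>. ?y u)"
    by (simp only: of_center_sum of_center_to_center_scaleR) (simp add: psi_def psibar_def)
  then have "berezin_integral \<Lambda> (gexp (\<Sum>u\<in>\<Lambda>. \<Sum>v\<in>\<Lambda>. A u v *\<^sub>R (psi \<Lambda> u * psibar \<Lambda> v))) =
      (\<Sum>T\<in>Pow \<Lambda>. berezin_integral \<Lambda> (of_center (prod ?y T)))"
    using assms gexp_of_center_sum[of \<Lambda> ?y] y2
    by (simp only: of_center_sum berezin_integral_sum)
  also have "\<dots> = (\<Sum>T\<in>{\<Lambda>}. berezin_integral \<Lambda> (of_center (prod ?y T)))"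
  proof (intro sum.mono_neutral_right ballI)
    fix T assume "T \<in> Pow \<Lambda> - {\<Lambda>}"
    then obtain v where v: "v \<in> \<Lambda>" "v \<notin> T" by blast
    have "\<not> involves (of_center (?y u)) (Psi v)" if "u \<in> T" for u
      unfolding y using v(2) that by (auto dest!: involves_times involves_sum involves_scaleR)
    then have "\<not> involves (of_center (prod ?y T)) (Psi v)"
      by (intro involves_of_center_prod) blast
    then show "berezin_integral \<Lambda> (of_center (prod ?y T)) = 0"
      using assms v(1) by (simp add: berezin_integral_def berezin_missing zero_grassmann.rep_eq)
  qed (use assms in auto)
  also have "\<dots> = (\<Sum>g\<in>\<Lambda> \<rightarrow>\<^sub>E \<Lambda>. berezin_integral \<Lambda> (of_center (\<Prod>u\<in>\<Lambda>. ?c u (g u))))"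
    using assms by (simp add: prod_sum_PiE of_center_sum berezin_integral_sum del: of_center_fermion_pair)
  also have "\<dots> = (\<Sum>g\<in>\<Lambda> \<rightarrow>\<^sub>E \<Lambda>. ?t g)"
    using assms by (simp only: of_center_prod_scaleR berezin_integral_scaleR)
  also have "\<dots> = (\<Sum>g | g \<in> \<Lambda> \<rightarrow>\<^sub>E \<Lambda> \<and> bij_betw g \<Lambda> \<Lambda>. ?t g)"
    using assms berezin_integral_function[OF assms]
    by (intro sum.mono_neutral_right) (auto simp: finite_PiE)
  also have "\<dots> = (\<Sum>p | p permutes \<Lambda>. ?t p)"
  \<comment> \<open>The functions on the left are \<open>undefined\<close> outside \<Lambda>,
    whereas permutations are the identity there; the witnesses convert between the two
    conventions.\<close>
  proof (rule sum.reindex_bij_witness[of _ "\<lambda>p. restrict p \<Lambda>" "\<lambda>g x. if x \<in> \<Lambda> then g x else x"])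
    fix g assume "g \<in> {g. g \<in> \<Lambda> \<rightarrow>\<^sub>E \<Lambda> \<and> bij_betw g \<Lambda> \<Lambda>}"
    then have g: "g \<in> \<Lambda> \<rightarrow>\<^sub>E \<Lambda>" "bij_betw g \<Lambda> \<Lambda>" by auto
    show "restrict (\<lambda>x. if x \<in> \<Lambda> then g x else x) \<Lambda> = g"
    proof
      fix x
      show "restrict (\<lambda>x. if x \<in> \<Lambda> then g x else x) \<Lambda> x = g x"
        using PiE_arb[OF g(1), of x] by (simp add: restrict_def)
    qed
    have "bij_betw (\<lambda>x. if x \<in> \<Lambda> then g x else x) \<Lambda> \<Lambda>"
      using g(2) by (subst bij_betw_cong[of \<Lambda> _ g]) auto
    then show "(\<lambda>x. if x \<in> \<Lambda> then g x else x) \<in> {p. p permutes \<Lambda>}"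
      by (auto intro: bij_imp_permutes)
    show "?t (\<lambda>x. if x \<in> \<Lambda> then g x else x) = ?t g"
      by simp
  next
    fix p assume "p \<in> {p. p permutes \<Lambda>}"
    then have p: "p permutes \<Lambda>" by simp
    show "(\<lambda>x. if x \<in> \<Lambda> then restrict p \<Lambda> x else x) = p"
      using permutes_not_in[OF p] by (intro ext) simp
    have "bij_betw (restrict p \<Lambda>) \<Lambda> \<Lambda>"
      using permutes_imp_bij[OF p] by (subst bij_betw_cong[of \<Lambda> _ p]) auto
    then show "restrict p \<Lambda> \<in> {g. g \<in> \<Lambda> \<rightarrow>\<^sub>E \<Lambda> \<and> bij_betw g \<Lambda> \<Lambda>}"
      using permutes_in_image[OF p] by auto
  qed
  also have "\<dots> = det_on \<Lambda> A"
    unfolding det_on_def using assms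
    by (intro sum.cong) (simp_all add: berezin_integral_permutation mult.commute)
  finally show ?thesis .
qed

section \<open>The degree field\<close>

lemma edges_meeting_iff:
  assumes "simple_graph W adj"
  shows "{u, v} \<in> edges_meeting adj \<Lambda> \<longleftrightarrow> adj u v \<and> (u \<in> \<Lambda> \<or> v \<in> \<Lambda>)"
  using assms unfolding edges_meeting_def simple_graph_def
  by (auto simp: doubleton_eq_iff)

lemma card_edges_at:
  assumes "simple_graph W adj" "v \<in> \<Lambda>"
  shows "card (edges_at adj \<Lambda> v) = card {w. adj v w}"
proof -
  have "edges_at adj \<Lambda> v = (\<lambda>w. {v, w}) ` {w. adj v w}"
    using assms by (auto simp: edges_at_def edges_meeting_def simple_graph_def insert_commute)
  moreover have "inj_on (\<lambda>w. {v, w}) {w. adj v w}"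
    by (auto simp: inj_on_def doubleton_eq_iff)
  ultimately show ?thesis
    by (simp add: card_image)
qed

text \<open>A common edge would join \<open>u\<close> and \<open>v\<close>, which are not neighbours
  in a good set.\<close>

lemma edges_at_disjoint:
  assumes "simple_graph W adj" "good_set adj \<Lambda> V" "u \<in> V" "v \<in> V" "u \<noteq> v"
  shows "edges_at adj \<Lambda> u \<inter> edges_at adj \<Lambda> v = {}"
proof -
  have "adj u v" if "e \<in> edges_meeting adj \<Lambda>" "u \<in> e" "v \<in> e" for e
    using that assms(1,5) by (auto simp: edges_meeting_def simple_graph_def)
  then show ?thesis
    using assms(2-4) by (auto simp: edges_at_def good_set_def)
qed

section \<open>The Laplacian as a sum over edges\<close>

definition endpoint_diff :: "('a set \<Rightarrow> 'a) \<Rightarrow> ('a set \<Rightarrow> 'a) \<Rightarrow> 'a set \<Rightarrow> 'a \<Rightarrow> real" where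
  "endpoint_diff tail tip e u = of_bool (tip e = u) - of_bool (tail e = u)"

lemma zeta_eq_sum:
  assumes "finite \<Lambda>"
  shows "zeta \<Lambda> tail tip e = (\<Sum>u\<in>\<Lambda>. \<Sum>v\<in>\<Lambda>.
    (endpoint_diff tail tip e u * endpoint_diff tail tip e v) *\<^sub>R (psi \<Lambda> u * psibar \<Lambda> v))"
proof -
  let ?d = "endpoint_diff tail tip e"
  have *: "psi \<Lambda> a = (\<Sum>u\<in>\<Lambda>. of_bool (a = u) *\<^sub>R psi \<Lambda> u)"
    "psibar \<Lambda> a = (\<Sum>u\<in>\<Lambda>. of_bool (a = u) *\<^sub>R psibar \<Lambda> u)" for a
    using assms
    by (auto simp: of_bool_def if_distrib[of "\<lambda>c. c *\<^sub>R _"] psi_def psibar_def cong: if_cong)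
  have "psi \<Lambda> (tip e) - psi \<Lambda> (tail e) = (\<Sum>u\<in>\<Lambda>. ?d u *\<^sub>R psi \<Lambda> u)"
    "psibar \<Lambda> (tip e) - psibar \<Lambda> (tail e) = (\<Sum>u\<in>\<Lambda>. ?d u *\<^sub>R psibar \<Lambda> u)"
    unfolding endpoint_diff_def scaleR_left_diff_distrib sum_subtractf
    by (simp_all only: * [symmetric])
  then show ?thesis
    by (simp add: zeta_def sum_product mult.commute)
qed

text \<open>On \<Lambda>, the negative Laplacian is the Gram matrix of the signed incidence vectors
  \<open>endpoint_diff\<close>. An edge leaving \<Lambda> contributes only to the diagonal, which
  therefore counts all neighbours.\<close>

lemma sum_zeta_eq_laplacian:
  assumes "simple_graph W adj" "finite \<Lambda>" "finite (edges_meeting adj \<Lambda>)"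
    "orientation (edges_meeting adj \<Lambda>) tail tip"
  shows "(\<Sum>u\<in>\<Lambda>. \<Sum>v\<in>\<Lambda>. (- laplacian adj u v) *\<^sub>R (psi \<Lambda> u * psibar \<Lambda> v)) =
    (\<Sum>e\<in>edges_meeting adj \<Lambda>. zeta \<Lambda> tail tip e)"
proof -
  let ?E = "edges_meeting adj \<Lambda>" and ?d = "endpoint_diff tail tip"
  have ends: "e = {tail e, tip e}" "tail e \<noteq> tip e" if "e \<in> ?E" for e
  proof -
    show e: "e = {tail e, tip e}"
      using assms(4) that unfolding orientation_def by blast
    have "\<exists>a b. e = {a, b} \<and> a \<noteq> b"
      using that assms(1) unfolding edges_meeting_def simple_graph_def by blast
    then show "tail e \<noteq> tip e"
      using e by (metis doubleton_eq_iff)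
  qed
  have lap: "(\<Sum>e\<in>?E. ?d e u * ?d e v) = - laplacian adj u v" if "u \<in> \<Lambda>" for u v
  proof (cases "u = v")
    case True
    have "(\<Sum>e\<in>?E. ?d e u * ?d e u) = (\<Sum>e\<in>?E. of_bool (u \<in> e))"
    proof (intro sum.cong refl)
      fix e assume "e \<in> ?E"
      then have "u \<in> e \<longleftrightarrow> u = tail e \<or> u = tip e" "tail e \<noteq> tip e"
        using ends by blast+
      then show "?d e u * ?d e u = of_bool (u \<in> e)"
        by (auto simp: endpoint_diff_def)
    qed
    also have "\<dots> = real (card (edges_at adj \<Lambda> u))"
      using assms(3) by (simp add: edges_at_def Int_def flip: sum.inter_filter)
    finally show ?thesis
      using True that by (simp add: laplacian_def card_edges_at[OF assms(1)])
  next
    case False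
    \<comment> \<open>Only the edge \<open>{u, v}\<close> has both vertices as ends, and it carries
      opposite signs there.\<close>
    have "(\<Sum>e\<in>?E. ?d e u * ?d e v) = (\<Sum>e\<in>?E. if e = {u, v} then - 1 else 0)"
    proof (intro sum.cong refl)
      fix e assume "e \<in> ?E"
      then have "e = {u, v} \<longleftrightarrow> tail e = u \<and> tip e = v \<or> tail e = v \<and> tip e = u" "tail e \<noteq> tip e"
        using ends by (metis doubleton_eq_iff)+
      then show "?d e u * ?d e v = (if e = {u, v} then - 1 else 0)"
        using False by (auto simp: endpoint_diff_def)
    qed
    also have "\<dots> = - laplacian adj u v"
      using assms(3) False that by (simp add: laplacian_def edges_meeting_iff[OF assms(1)])
    finally show ?thesis .
  qed
  have "(\<Sum>e\<in>?E. zeta \<Lambda> tail tip e) =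
      (\<Sum>u\<in>\<Lambda>. \<Sum>v\<in>\<Lambda>. \<Sum>e\<in>?E. (?d e u * ?d e v) *\<^sub>R (psi \<Lambda> u * psibar \<Lambda> v))"
    unfolding zeta_eq_sum[OF assms(2)]
    by (subst sum.swap, intro sum.cong refl) (rule sum.swap)
  also have "\<dots> = (\<Sum>u\<in>\<Lambda>. \<Sum>v\<in>\<Lambda>. (- laplacian adj u v) *\<^sub>R (psi \<Lambda> u * psibar \<Lambda> v))"
    by (intro sum.cong refl) (simp only: scaleR_left.sum [symmetric] lap)
  finally show ?thesis ..
qed

section \<open>Degree constraints and the counting of trees\<close>

text \<open>
  Since \<open>(1 + z e) * (1 - z e) = 1\<close>, multiplying by \<open>\<Prod>e\<in>B v. 1 - z e\<close> removes the edges of \<open>B v\<close> from the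
  free sum over subsets, and the elementary symmetric polynomial puts \<open>k v\<close> of them back.
\<close>

lemma sum_subsets_times_local:
  fixes z :: "'i \<Rightarrow> 'b :: comm_ring_1" and B :: "'v \<Rightarrow> 'i set"
  assumes "finite E" "finite V" "\<And>v. v \<in> V \<Longrightarrow> B v \<subseteq> E"
    and "\<And>u v. u \<in> V \<Longrightarrow> v \<in> V \<Longrightarrow> u \<noteq> v \<Longrightarrow> B u \<inter> B v = {}"
    and sq: "\<And>e. z e * z e = 0"
  shows "(\<Sum>T\<in>Pow E. prod z T) *
      (\<Prod>v\<in>V. (\<Sum>S | S \<subseteq> B v \<and> card S = k v. prod z S) * (\<Prod>e\<in>B v. 1 - z e)) =
    (\<Sum>T | T \<subseteq> E \<and> (\<forall>v\<in>V. card (T \<inter> B v) = k v). prod z T)"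
  using assms(2,3,4)
proof (induction V rule: finite_induct)
  case empty
  then show ?case by (simp add: Pow_def)
next
  case (insert v V)
  let ?X = "\<lambda>v. \<Sum>S | S \<subseteq> B v \<and> card S = k v. prod z S" and ?Y = "\<lambda>v. \<Prod>e\<in>B v. 1 - z e"
  let ?P = "\<lambda>T. \<forall>u\<in>V. card (T \<inter> B u) = k u"
  let ?G = "\<Sum>T | T \<subseteq> E - B v \<and> ?P T. prod z T"
  have B: "B v \<subseteq> E" "finite (B v)"
    using insert.prems(1)[of v] assms(1) by (auto intro: finite_subset)
  \<comment> \<open>By disjointness, deleting the edges of \<open>B v\<close> leaves the constraints
    at the other vertices unchanged.\<close>
  have P: "?P (T - B v) \<longleftrightarrow> ?P T" for T
  proof -
    have "(T - B v) \<inter> B u = T \<inter> B u" if "u \<in> V" for u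
      using insert.prems(2)[of u v] insert.hyps(2) that by blast
    then show ?thesis by simp
  qed
  have inv: "(\<Prod>e\<in>B v. 1 + z e) * ?Y v = 1"
    using sq by (simp add: algebra_simps flip: prod.distrib)
  \<comment> \<open>The edges of \<open>B v\<close> are still unconstrained here, so they split off
    as a factor, which is the inverse of \<open>?Y v\<close>.\<close>
  have F: "(\<Sum>T | T \<subseteq> E \<and> ?P T. prod z T) = ?G * (\<Prod>e\<in>B v. 1 + z e)"
    using sum_subsets_split[OF assms(1) B(1), of z ?P "\<lambda>_. True"] prod_one_plus[OF B(2), of z]
    by (simp add: P)
  have "(\<Sum>T\<in>Pow E. prod z T) * (\<Prod>u\<in>insert v V. ?X u * ?Y u) =
      (\<Sum>T\<in>Pow E. prod z T) * (\<Prod>u\<in>V. ?X u * ?Y u) * (?X v * ?Y v)"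
    unfolding prod.insert[OF insert.hyps] by (simp only: mult_ac)
  also have "(\<Sum>T\<in>Pow E. prod z T) * (\<Prod>u\<in>V. ?X u * ?Y u) = (\<Sum>T | T \<subseteq> E \<and> ?P T. prod z T)"
    using insert.prems by (intro insert.IH) simp_all
  also have "\<dots> * (?X v * ?Y v) = ?G * ?X v * ((\<Prod>e\<in>B v. 1 + z e) * ?Y v)"
    unfolding F by (simp only: mult_ac)
  also have "\<dots> = (\<Sum>T | T \<subseteq> E \<and> (\<forall>u\<in>insert v V. card (T \<inter> B u) = k u). prod z T)"
    using sum_subsets_split[OF assms(1) B(1), of z ?P "\<lambda>S. card S = k v", symmetric]
    unfolding inv by (simp add: P conj_commute)
  finally show ?case .
qed

text \<open>All factors are images of central elements, so the product is computed in the center,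
  where \<open>sum_subsets_times_local\<close> applies to the disjoint sets of edges at the vertices
  of \<open>V\<close>.\<close>

lemma fgff_integrand:
  assumes "simple_graph W adj" "finite \<Lambda>" "finite (edges_meeting adj \<Lambda>)"
    "orientation (edges_meeting adj \<Lambda>) tail tip" "good_set adj \<Lambda> V"
  shows "gexp (\<Sum>u\<in>\<Lambda>. \<Sum>v\<in>\<Lambda>. (- laplacian adj u v) *\<^sub>R (psi \<Lambda> u * psibar \<Lambda> v)) *
      cprod (\<lambda>v. X_field adj \<Lambda> tail tip v (k v) * Y_field adj \<Lambda> tail tip v) V =
    (\<Sum>T | T \<subseteq> edges_meeting adj \<Lambda> \<and> (\<forall>v\<in>V. tree_degree adj \<Lambda> v T = k v).
      cprod (zeta \<Lambda> tail tip) T)"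
proof -
  let ?E = "edges_meeting adj \<Lambda>" and ?z = "zeta_center \<Lambda> tail tip" and ?B = "edges_at adj \<Lambda>"
  let ?X = "\<lambda>v. \<Sum>S | S \<subseteq> ?B v \<and> card S = k v. prod ?z S" and ?Y = "\<lambda>v. \<Prod>e\<in>?B v. 1 - ?z e"
  have B: "?B v \<subseteq> ?E" for v
    by (auto simp: edges_at_def)
  then have finB: "finite (?B v)" for v
    using assms(3) by (rule finite_subset)
  have deg: "card (T \<inter> ?B v) = tree_degree adj \<Lambda> v T" for T v
    using finB by (simp add: tree_degree_def Int_commute)
  have "finite V"
    using assms(2,5) by (auto simp: good_set_def intro: finite_subset)
  have "gexp (\<Sum>u\<in>\<Lambda>. \<Sum>v\<in>\<Lambda>. (- laplacian adj u v) *\<^sub>R (psi \<Lambda> u * psibar \<Lambda> v)) =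
      of_center (\<Sum>T\<in>Pow ?E. prod ?z T)"
    using gexp_of_center_sum[OF assms(3), of ?z]
    by (simp add: sum_zeta_eq_laplacian[OF assms(1-4)] of_center_sum del: scaleR_minus_left)
  moreover have "X_field adj \<Lambda> tail tip v (k v) = of_center (?X v)" for v
    by (simp add: X_field_def cprod_zeta of_center_sum)
  moreover have "Y_field adj \<Lambda> tail tip v = of_center (?Y v)" for v
    using cprod_of_center[of "\<lambda>e. 1 - ?z e" "?B v"] by (simp add: Y_field_def)
  ultimately have "gexp (\<Sum>u\<in>\<Lambda>. \<Sum>v\<in>\<Lambda>. (- laplacian adj u v) *\<^sub>R (psi \<Lambda> u * psibar \<Lambda> v)) *
      cprod (\<lambda>v. X_field adj \<Lambda> tail tip v (k v) * Y_field adj \<Lambda> tail tip v) V =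
      of_center ((\<Sum>T\<in>Pow ?E. prod ?z T) * (\<Prod>v\<in>V. ?X v * ?Y v))"
    by (simp only: times_center.rep_eq [symmetric] cprod_of_center)
  also have "(\<Sum>T\<in>Pow ?E. prod ?z T) * (\<Prod>v\<in>V. ?X v * ?Y v) =
      (\<Sum>T | T \<subseteq> ?E \<and> (\<forall>v\<in>V. card (T \<inter> ?B v) = k v). prod ?z T)"
    using assms(3) \<open>finite V\<close> B edges_at_disjoint[OF assms(1,5)]
    by (intro sum_subsets_times_local) simp_all
  finally show ?thesis
    by (simp add: of_center_sum cprod_zeta deg)
qed

text \<open>Each edge set contributes 1 or 0 by \<open>gcoeff_berezin_cprod_zeta\<close>, which
  turns the integral into a count.\<close>

lemma berezin_integral_sum_cprod_zeta:
  assumes "finite \<Lambda>" "finite E" "orientation E tail tip"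
  shows "berezin_integral \<Lambda> (\<Sum>T | T \<subseteq> E \<and> P T. cprod (zeta \<Lambda> tail tip) T) =
    card {T. T \<subseteq> E \<and> cut_connected \<Lambda> T \<and> card T = card \<Lambda> \<and> P T}"
proof -
  have "berezin_integral \<Lambda> (\<Sum>T | T \<subseteq> E \<and> P T. cprod (zeta \<Lambda> tail tip) T) =
      (\<Sum>T | T \<subseteq> E \<and> P T. of_bool (cut_connected \<Lambda> T \<and> card T = card \<Lambda>))"
    unfolding berezin_integral_sum[OF assms(1)] unfolding berezin_integral_def
  proof (intro sum.cong refl)
    fix T assume "T \<in> {T. T \<subseteq> E \<and> P T}"
    then show "gcoeff (berezin \<Lambda> (cprod (zeta \<Lambda> tail tip) T)) {} =
        of_bool (cut_connected \<Lambda> T \<and> card T = card \<Lambda>)"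
      using assms by (intro gcoeff_berezin_cprod_zeta) (auto simp: orientation_def intro: finite_subset)
  qed
  also have "\<dots> = card {T \<in> {T. T \<subseteq> E \<and> P T}. cut_connected \<Lambda> T \<and> card T = card \<Lambda>}"
    using assms(2) by (simp add: Int_def)
  also have "{T \<in> {T. T \<subseteq> E \<and> P T}. cut_connected \<Lambda> T \<and> card T = card \<Lambda>} =
      {T. T \<subseteq> E \<and> cut_connected \<Lambda> T \<and> card T = card \<Lambda> \<and> P T}"
    by blast
  finally show ?thesis .
qed

theorem theorem3p9:
  fixes W :: "'a set" and adj :: "'a \<Rightarrow> 'a \<Rightarrow> bool" and \<Lambda> V :: "'a set"
    and tail tip :: "'a set \<Rightarrow> 'a" and k :: "'a \<Rightarrow> nat"
  assumes "simple_graph W adj" and "connected_graph W adj" and "locally_finite_graph W adj"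
    and "finite \<Lambda>" and "\<Lambda> \<noteq> {}" and "\<Lambda> \<subset> W"
    and "orientation (edges_meeting adj \<Lambda>) tail tip"
    and "good_set adj \<Lambda> V"
    and "\<forall>v\<in>V. k v \<in> {1..card (edges_at adj \<Lambda> v)}"
  shows "measure_pmf.prob (ust W adj \<Lambda>) {T. \<forall>v\<in>V. tree_degree adj \<Lambda> v T = k v} =
           measure_pmf.expectation (ust W adj \<Lambda>) (\<lambda>T. \<Prod>v\<in>V. degree_indicator adj \<Lambda> v (k v) T) \<and>
         measure_pmf.expectation (ust W adj \<Lambda>) (\<lambda>T. \<Prod>v\<in>V. degree_indicator adj \<Lambda> v (k v) T) =
           fgff_state adj \<Lambda>
             (cprod (\<lambda>v. X_field adj \<Lambda> tail tip v (k v) * Y_field adj \<Lambda> tail tip v) V)"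
proof -
  let ?E = "edges_meeting adj \<Lambda>" and ?trees = "wired_spanning_trees W adj \<Lambda>"
  let ?D = "{T. \<forall>v\<in>V. tree_degree adj \<Lambda> v T = k v}"
  let ?F = "\<lambda>v. X_field adj \<Lambda> tail tip v (k v) * Y_field adj \<Lambda> tail tip v"
  let ?S = "gexp (\<Sum>u\<in>\<Lambda>. \<Sum>v\<in>\<Lambda>. (- laplacian adj u v) *\<^sub>R (psi \<Lambda> u * psibar \<Lambda> v))"
  have finE: "finite ?E"
    using assms by (intro finite_edges_meeting) auto
  have trees: "?trees = {T. T \<subseteq> ?E \<and> cut_connected \<Lambda> T \<and> card T = card \<Lambda>}"
    using assms by (intro wired_spanning_trees_eq)
  have fin: "finite ?trees"
    unfolding trees using finE by simp
  \<comment> \<open>At least one tree is required for the uniform distribution to be given by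
    counting.\<close>
  have "\<exists>T\<subseteq>?E. finite T \<and> cut_connected \<Lambda> T \<and> card T = card \<Lambda>"
    using cut_connected_edges_meeting[OF assms(2,6)] assms(4)
    by (intro cut_connected_spanning_subset) (auto simp: edges_meeting_def)
  then have ne: "?trees \<noteq> {}"
    unfolding trees by blast
  have "finite V"
    using assms(4,8) by (auto simp: good_set_def intro: finite_subset)
  then have ind: "(\<Prod>v\<in>V. degree_indicator adj \<Lambda> v (k v) T) = indicator ?D T" for T
    by (auto simp: degree_indicator_def indicator_def prod_zero_iff)
  have prob: "measure_pmf.prob (ust W adj \<Lambda>) ?D = card (?trees \<inter> ?D) / card ?trees"
    unfolding ust_def using ne fin by (rule measure_pmf_of_set)
  \<comment> \<open>The normalization is the case without degree constraints: the product over no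
    vertices is 1, and the Gaussian integral counts all spanning trees. This is the matrix-tree
    theorem.\<close>
  have "det_on \<Lambda> (\<lambda>u v. - laplacian adj u v) =
      berezin_integral \<Lambda> (?S * cprod ?F {})"
    using berezin_integral_gexp[OF assms(4), of "\<lambda>u v. - laplacian adj u v"]
    by (simp add: cprod_def)
  also have "\<dots> = card ?trees"
    unfolding trees using assms finE
    by (subst fgff_integrand[OF assms(1,4) finE assms(7)])
      (simp_all add: good_set_def berezin_integral_sum_cprod_zeta[where P = "\<lambda>_. True", simplified])
  finally have det: "det_on \<Lambda> (\<lambda>u v. - laplacian adj u v) = card ?trees" .
  have "berezin_integral \<Lambda> (?S * cprod ?F V) =
      card {T. T \<subseteq> ?E \<and> cut_connected \<Lambda> T \<and> card T = card \<Lambda> \<and>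
        (\<forall>v\<in>V. tree_degree adj \<Lambda> v T = k v)}"
    unfolding fgff_integrand[OF assms(1,4) finE assms(7,8)]
    using assms(4,7) finE by (intro berezin_integral_sum_cprod_zeta)
  also have "{T. T \<subseteq> ?E \<and> cut_connected \<Lambda> T \<and> card T = card \<Lambda> \<and>
        (\<forall>v\<in>V. tree_degree adj \<Lambda> v T = k v)} =
      ?trees \<inter> ?D"
    unfolding trees by blast
  \<comment> \<open>The integral counts the trees with the prescribed degrees and the determinant
    counts all trees, so the quotient is the uniform probability.\<close>
  finally have "fgff_state adj \<Lambda> (cprod ?F V) =
      card (?trees \<inter> ?D) / card ?trees"
    unfolding fgff_state_def det by (simp add: berezin_integral_def)
  then show ?thesis
    using prob by (simp add: ind)
qed

end
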